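(* Let $(\mathfrak{X}, \Gamma, \Phi)$ be a minimal equicontinuous Cantor action. Then the Steinitz orders $\Pi[\mathfrak{G}(\Phi)]$, $\Pi[\mathfrak{D}(\Phi)]$ and $\Pi[\mathfrak{G}(\Phi):\mathfrak{D}(\Phi)]$ are independent of the choice of the basepoint $x \in \mathfrak{X}$. Moreover, these three Steinitz orders depend only on the isomorphism class of the action (isomorphic minimal equicontinuous Cantor actions have equal Steinitz orders), and they satisfy the Lagrange identity $$\Pi[\mathfrak{G}(\Phi)] = \Pi[\mathfrak{G}(\Phi):\mathfrak{D}(\Phi)] \cdot \Pi[\mathfrak{D}(\Phi)],$$ where the multiplication is multiplication of Steinitz numbers.
   Context: A Cantor action $(\mathfrak{X}, \Gamma, \Phi)$ consists of a countable group $\Gamma$, a Cantor space $\mathfrak{X}$ and a minimal action $\Phi \colon \Gamma \times \mathfrak{X} \to \mathfrak{X}$ by homeomorphisms (every orbit is dense). It is equicontinuous if, for a metric $d_{\mathfrak{X}}$ compatible with the topology, for all $\varepsilon>0$ there is $\delta>0$ such that $d_{\mathfrak{X}}(x,y)<\delta$ implies $d_{\mathfrak{X}}(\gamma x,\gamma y)<\varepsilon$ for all $\gamma\in\Gamma$. For such an action, $\mathfrak{G}(\Phi) = \overline{\Phi(\Gamma)} \subset \mathrm{Homeo}(\mathfrak{X})$ denotes the closure in the uniform topology; it is a profinite group, acting transitively on $\mathfrak{X}$. For $x \in \mathfrak{X}$, $\mathfrak{D}(\Phi,x) = \{\widehat g \in \mathfrak{G}(\Phi) \mid \widehat g\, x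 = x\}$ is the isotropy group (discriminant). A Steinitz number is a formal product $\prod_{p} p^{n(p)}$ over all primes, with $0 \leq n(p) \leq \infty$; multiplication adds exponents, and $LCM$ of a collection takes the supremum of exponents at each prime. With a basepoint $x \in \mathfrak{X}$ chosen, the Steinitz orders of the action are ($\mathfrak{N}$ ranging over open normal subgroups of $\mathfrak{G}(\Phi)$): - $\Pi[\mathfrak{G}(\Phi)] = LCM\{\#\, \mathfrak{G}(\Phi)/\mathfrak{N}\}$; - $\Pi[\mathfrak{D}(\Phi)] = LCM\{\#\, \mathfrak{D}(\Phi,x)/(\mathfrak{N}\cap\mathfrak{D}(\Phi,x))\}$; - $\Pi[\mathfrak{G}(\Phi):\mathfrak{D}(\Phi)] = LCM\{\#\, \mathfrak{G}(\Phi)/(\mathfrak{N}\cdot\mathfrak{D}(\Phi,x))\}$. Cantor actions $(\mathfrak{X}_1,\Gamma_1,\Phi_1)$ and $(\mathfrak{X}_2,\Gamma_2,\Phi_2)$ are isomorphic if there are a homeomorphism $h \colon \mathfrak{X}_1 \to \mathfrak{X}_2$ and a group isomorphism $\Theta \colon \Gamma_1 \to \Gamma_2$ with $\Phi_1(g) = h^{-1}\circ\Phi_2(\Theta(g))\circ h$ for all $g \in \Gamma_1$. *)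

theory Defs
  imports "HOL-Analysis.Analysis" "HOL-Algebra.Group_Action" "HOL-Algebra.Left_Coset"
    "HOL-Library.Extended_Nat" "HOL-Computational_Algebra.Primes"
begin

section \<open>Steinitz numbers\<close>

text \<open>A formal product over the primes is represented by its exponent function, which is set to
  \<open>0\<close> at non-primes so that equality of Steinitz numbers is equality of exponents at primes.\<close>

typedef steinitz = "{e :: nat \<Rightarrow> enat. \<forall>p. \<not> prime p \<longrightarrow> e p = 0}"
  morphisms exponent Abs_steinitz
  by (rule exI[of _ "\<lambda>_. 0"]) simp

setup_lifting type_definition_steinitz

instantiation steinitz :: times
begin

lift_definition times_steinitz :: "steinitz \<Rightarrow> steinitz \<Rightarrow> steinitz"
  is "\<lambda>a b p. a p + b p"
  by simp

instance ..

end

lift_definition steinitz_LCM :: "steinitz set \<Rightarrow> steinitz"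
  is "\<lambda>A p. SUP a\<in>A. a p"
proof -
  fix A :: "(nat \<Rightarrow> enat) set" and p :: nat
  assume "\<And>e q. e \<in> A \<Longrightarrow> \<not> prime q \<Longrightarrow> e q = 0" "\<not> prime p"
  then have "(SUP a\<in>A. a p) \<le> 0"
    by (intro SUP_least) auto
  then show "(SUP a\<in>A. a p) = 0"
    by simp
qed

text \<open>Only meaningful for \<open>n > 0\<close>.\<close>

lift_definition steinitz_of_nat :: "nat \<Rightarrow> steinitz"
  is "\<lambda>n p. if prime p then enat (multiplicity p n) else 0"
  by simp


section \<open>Cantor actions\<close>

definition cantor_space :: "'x topology \<Rightarrow> bool" where
  "cantor_space X \<longleftrightarrow>
     X homeomorphic_space product_topology (\<lambda>_::nat. discrete_topology (UNIV :: bool set)) UNIV"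

text \<open>Following \<^locale>\<open>group_action\<close>, each \<open>\<phi> g\<close> is a bijection of the space that is
  \<^const>\<open>extensional\<close>, i.e. \<^const>\<open>undefined\<close> outside the space.\<close>

definition cantor_action :: "'x topology \<Rightarrow> ('g, 'c) monoid_scheme \<Rightarrow> ('g \<Rightarrow> 'x \<Rightarrow> 'x) \<Rightarrow> bool" where
  "cantor_action X \<Gamma> \<phi> \<longleftrightarrow>
     cantor_space X \<and>
     group_action \<Gamma> (topspace X) \<phi> \<and>
     countable (carrier \<Gamma>) \<and>
     (\<forall>g\<in>carrier \<Gamma>. homeomorphic_map X X (\<phi> g)) \<and>
     (\<forall>x\<in>topspace X. X closure_of orbit \<Gamma> \<phi> x = topspace X)"

definition equicontinuous_action ::
    "'x metric \<Rightarrow> ('g, 'c) monoid_scheme \<Rightarrow> ('g \<Rightarrow> 'x \<Rightarrow> 'x) \<Rightarrow> bool" where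
  "equicontinuous_action m \<Gamma> \<phi> \<longleftrightarrow>
     (\<forall>\<epsilon>>0. \<exists>\<delta>>0. \<forall>x\<in>mspace m. \<forall>y\<in>mspace m. mdist m x y < \<delta> \<longrightarrow>
        (\<forall>g\<in>carrier \<Gamma>. mdist m (\<phi> g x) (\<phi> g y) < \<epsilon>))"

text \<open>A minimal equicontinuous Cantor action, given together with a metric \<open>m\<close> compatible with the
  topology of the Cantor space.\<close>

definition equicontinuous_cantor_action ::
    "'x metric \<Rightarrow> ('g, 'c) monoid_scheme \<Rightarrow> ('g \<Rightarrow> 'x \<Rightarrow> 'x) \<Rightarrow> bool" where
  "equicontinuous_cantor_action m \<Gamma> \<phi> \<longleftrightarrow>
     cantor_action (mtopology_of m) \<Gamma> \<phi> \<and> equicontinuous_action m \<Gamma> \<phi>"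

text \<open>Isomorphism does not involve the metrics, only the topologies; \<open>h'\<close> is the inverse of \<open>h\<close>.\<close>

definition isomorphic_actions ::
    "'x topology \<Rightarrow> ('g, 'c) monoid_scheme \<Rightarrow> ('g \<Rightarrow> 'x \<Rightarrow> 'x) \<Rightarrow>
     'y topology \<Rightarrow> ('h, 'd) monoid_scheme \<Rightarrow> ('h \<Rightarrow> 'y \<Rightarrow> 'y) \<Rightarrow> bool" where
  "isomorphic_actions X1 \<Gamma>1 \<phi>1 X2 \<Gamma>2 \<phi>2 \<longleftrightarrow>
     (\<exists>h h' \<Theta>. homeomorphic_maps X1 X2 h h' \<and> \<Theta> \<in> iso \<Gamma>1 \<Gamma>2 \<and>
        (\<forall>g\<in>carrier \<Gamma>1. \<forall>x\<in>topspace X1. \<phi>1 g x = h' (\<phi>2 (\<Theta> g) (h x))))"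


section \<open>The closure group and its Steinitz orders\<close>

definition homeos :: "'x topology \<Rightarrow> ('x \<Rightarrow> 'x) set" where
  "homeos X = {f \<in> extensional (topspace X). homeomorphic_map X X f}"

text \<open>The value \<open>0\<close> off \<^const>\<open>homeos\<close> is needed because \<^locale>\<open>Metric_space\<close> asks for a distance that is
  nonnegative on the whole type.\<close>

definition sup_dist :: "'x metric \<Rightarrow> ('x \<Rightarrow> 'x) \<Rightarrow> ('x \<Rightarrow> 'x) \<Rightarrow> real" where
  "sup_dist m f g =
     (if f \<in> homeos (mtopology_of m) \<and> g \<in> homeos (mtopology_of m)
      then SUP x\<in>mspace m. mdist m (f x) (g x) else 0)"

definition uniform_topology :: "'x metric \<Rightarrow> ('x \<Rightarrow> 'x) topology" where
  "uniform_topology m = Metric_space.mtopology (homeos (mtopology_of m)) (sup_dist m)"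

lemma Metric_space_sup_dist:
  assumes "compact_space (mtopology_of m)" and "mspace m \<noteq> {}"
  shows "Metric_space (homeos (mtopology_of m)) (sup_dist m)"
proof -
  have maps: "f x \<in> mspace m" if "f \<in> homeos (mtopology_of m)" "x \<in> mspace m" for f x
    using that homeomorphic_imp_surjective_map by (fastforce simp: homeos_def)
  have "Metric_space.mbounded (mspace m) (mdist m) (mspace m)"
    using assms(1) Metric_space.compactin_imp_mbounded[OF Metric_space_mspace_mdist, of m "mspace m"]
    by (simp add: compact_space_def mtopology_of_def Metric_space.topspace_mtopology)
  then obtain B where B: "\<And>x y. x \<in> mspace m \<Longrightarrow> y \<in> mspace m \<Longrightarrow> mdist m x y \<le> B"
    using Metric_space.mbounded_alt[OF Metric_space_mspace_mdist, of m "mspace m"] by blast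
  have bdd: "bdd_above ((\<lambda>x. mdist m (f x) (g x)) ` mspace m)"
    if "f \<in> homeos (mtopology_of m)" "g \<in> homeos (mtopology_of m)" for f g
    using that by (intro bdd_aboveI2[of _ _ B]) (simp add: B maps)
  have upper: "mdist m (f x) (g x) \<le> sup_dist m f g"
    if "f \<in> homeos (mtopology_of m)" "g \<in> homeos (mtopology_of m)" "x \<in> mspace m" for f g x
    using that bdd by (auto simp: sup_dist_def intro: cSUP_upper)
  obtain x0 where x0: "x0 \<in> mspace m"
    using assms(2) by blast
  have nonneg: "0 \<le> sup_dist m f g" for f g
  proof (cases "f \<in> homeos (mtopology_of m) \<and> g \<in> homeos (mtopology_of m)")
    case True
    then show ?thesis
      using upper[of f g x0] x0 mdist_nonneg[of m "f x0" "g x0"] by linarith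
  qed (auto simp: sup_dist_def)
  have comm: "sup_dist m f g = sup_dist m g f" for f g
    by (simp add: sup_dist_def mdist_commute)
  have pos: "0 < sup_dist m f g"
    if f: "f \<in> homeos (mtopology_of m)" and g: "g \<in> homeos (mtopology_of m)" and "f \<noteq> g" for f g
  proof -
    have "f \<in> extensional (mspace m)" "g \<in> extensional (mspace m)"
      using f g by (auto simp: homeos_def)
    then obtain x where x: "x \<in> mspace m" "f x \<noteq> g x"
      using \<open>f \<noteq> g\<close> extensionalityI by blast
    then have "0 < mdist m (f x) (g x)"
      using maps[OF f x(1)] maps[OF g x(1)] Metric_space.mdist_pos_eq[OF Metric_space_mspace_mdist]
      by metis
    then show ?thesis
      using upper[OF f g x(1)] by linarith
  qed
  have zero: "sup_dist m f f = 0" if "f \<in> homeos (mtopology_of m)" for f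
  proof -
    have "(SUP x\<in>mspace m. mdist m (f x) (f x)) = (SUP x\<in>mspace m. 0)"
      using that maps by (intro SUP_cong) auto
    then show ?thesis
      using assms(2) by (simp add: sup_dist_def)
  qed
  have tri: "sup_dist m f k \<le> sup_dist m f g + sup_dist m g k"
    if f: "f \<in> homeos (mtopology_of m)" and g: "g \<in> homeos (mtopology_of m)"
      and k: "k \<in> homeos (mtopology_of m)" for f g k
  proof -
    have "(SUP x\<in>mspace m. mdist m (f x) (k x)) \<le> sup_dist m f g + sup_dist m g k"
    proof (rule cSUP_least[OF assms(2)])
      fix x assume x: "x \<in> mspace m"
      have "mdist m (f x) (k x) \<le> mdist m (f x) (g x) + mdist m (g x) (k x)"
        using maps f g k x mdist_triangle by metis
      then show "mdist m (f x) (k x) \<le> sup_dist m f g + sup_dist m g k"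
        using upper[OF f g x] upper[OF g k x] by linarith
    qed
    then show ?thesis
      using f k by (simp add: sup_dist_def)
  qed
  show ?thesis
  proof
    show "sup_dist m f g = 0 \<longleftrightarrow> f = g"
      if "f \<in> homeos (mtopology_of m)" "g \<in> homeos (mtopology_of m)" for f g
      using pos[OF that] zero[OF that(1)] by (cases "f = g") auto
  qed (use nonneg comm tri in auto)
qed

text \<open>The group \<open>\<GG>(\<Phi>)\<close>, with composition of homeomorphisms as multiplication.\<close>

definition closure_group ::
    "'x metric \<Rightarrow> ('g, 'c) monoid_scheme \<Rightarrow> ('g \<Rightarrow> 'x \<Rightarrow> 'x) \<Rightarrow> ('x \<Rightarrow> 'x) monoid" where
  "closure_group m \<Gamma> \<phi> =
     (BijGroup (mspace m))\<lparr>carrier := uniform_topology m closure_of (\<phi> ` carrier \<Gamma>)\<rparr>"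

definition discriminant ::
    "'x metric \<Rightarrow> ('g, 'c) monoid_scheme \<Rightarrow> ('g \<Rightarrow> 'x \<Rightarrow> 'x) \<Rightarrow> 'x \<Rightarrow> ('x \<Rightarrow> 'x) set" where
  "discriminant m \<Gamma> \<phi> x = stabilizer (closure_group m \<Gamma> \<phi>) (\<lambda>f. f) x"

definition open_normal_subgroups ::
    "'x metric \<Rightarrow> ('g, 'c) monoid_scheme \<Rightarrow> ('g \<Rightarrow> 'x \<Rightarrow> 'x) \<Rightarrow> ('x \<Rightarrow> 'x) set set" where
  "open_normal_subgroups m \<Gamma> \<phi> =
     {N. N \<lhd> closure_group m \<Gamma> \<phi> \<and>
         openin (subtopology (uniform_topology m) (carrier (closure_group m \<Gamma> \<phi>))) N}"

text \<open>For an equicontinuous Cantor action \<open>\<GG>(\<Phi>)\<close> is compact, so all quotients below are finite.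
  In the relative order, \<open>N \<cdot> D\<close> need not be normal, so the quotient is a set of left cosets.\<close>

definition steinitz_order_group ::
    "'x metric \<Rightarrow> ('g, 'c) monoid_scheme \<Rightarrow> ('g \<Rightarrow> 'x \<Rightarrow> 'x) \<Rightarrow> steinitz" where
  "steinitz_order_group m \<Gamma> \<phi> =
     steinitz_LCM ((\<lambda>N. steinitz_of_nat (card (carrier (closure_group m \<Gamma> \<phi> Mod N))))
       ` open_normal_subgroups m \<Gamma> \<phi>)"

definition steinitz_order_discriminant ::
    "'x metric \<Rightarrow> ('g, 'c) monoid_scheme \<Rightarrow> ('g \<Rightarrow> 'x \<Rightarrow> 'x) \<Rightarrow> 'x \<Rightarrow> steinitz" where
  "steinitz_order_discriminant m \<Gamma> \<phi> x =
     (let D = discriminant m \<Gamma> \<phi> x in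
      steinitz_LCM
        ((\<lambda>N. steinitz_of_nat
           (card (carrier ((closure_group m \<Gamma> \<phi>)\<lparr>carrier := D\<rparr> Mod (N \<inter> D)))))
         ` open_normal_subgroups m \<Gamma> \<phi>))"

definition steinitz_relative_order ::
    "'x metric \<Rightarrow> ('g, 'c) monoid_scheme \<Rightarrow> ('g \<Rightarrow> 'x \<Rightarrow> 'x) \<Rightarrow> 'x \<Rightarrow> steinitz" where
  "steinitz_relative_order m \<Gamma> \<phi> x =
     (let G = closure_group m \<Gamma> \<phi>; D = discriminant m \<Gamma> \<phi> x in
      steinitz_LCM
        ((\<lambda>N. steinitz_of_nat (card (lcosets\<^bsub>G\<^esub> (N <#>\<^bsub>G\<^esub> D))))
         ` open_normal_subgroups m \<Gamma> \<phi>))"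

end

theory Submission
  imports Defs "HOL-Algebra.SndIsomorphismGrp"
begin

text \<open>By equicontinuity the closure group is a totally bounded group of homeomorphisms whose open normal
  subgroups have finite index. For each of them, say \<open>N\<close>, multiplicativity of the index and the second
  isomorphism theorem give \<open>[G : N] = [G : ND] [D : N \<inter> D]\<close>. Both factors grow, in the sense of
  divisibility, as \<open>N\<close> shrinks, and the subgroups \<open>N\<close> are closed under intersection, so the suprema of the
  exponents of the two factors add up. As the closure group acts transitively, the isotropy groups of two
  points are conjugate by an element that fixes every \<open>N\<close>. Finally an isomorphism of actions conjugates one
  closure group to the other; it respects open subgroups, because a homeomorphism of compact metric
  spaces is uniformly continuous in both directions.\<close>

section \<open>Indices of subgroups\<close>

text \<open>An infinite set has \<open>card\<close> 0 and the multiplicity of a prime in 0 is 0, so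
  an infinite quotient would count as if it were trivial. Finiteness of the indices is therefore
  proved before any product formula for exponents is used. The Lagrange identity then meets one
  obstacle: the suprema of two summands may be attained at different subgroups. An intersection lies
  below both of them, and passing to it loses nothing, because both indices can only be multiplied.
  On the topological side, everything is reduced to estimates at points: membership in the closure
  group becomes uniform approximation by \<Gamma>, and openness of a normal subgroup becomes the
  presence of all group elements that move every point by less than some \<epsilon>. Equicontinuity
  is used mostly through inverses: elements of \<Gamma> and their inverses share one modulus of
  continuity, and this is why uniform limits of the action remain invertible and why their inverses
  are again such limits.\<close>

lemma card_image_cong_fibres:
  assumes "\<And>a b. a \<in> A \<Longrightarrow> b \<in> A \<Longrightarrow> f a = f b \<longleftrightarrow> g a = g b"
  shows "card (f ` A) = card (g ` A)"
proof -
  let ?r = "\<lambda>y. g (inv_into A f y)"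
  have r: "?r (f a) = g a" if "a \<in> A" for a
    using that assms[of "inv_into A f (f a)" a] by (simp add: f_inv_into_f inv_into_into)
  have "inj_on ?r (f ` A)"
    using assms r by (auto simp: inj_on_def)
  moreover have "?r ` f ` A = g ` A"
    using r by (auto simp: image_iff)
  ultimately show ?thesis
    by (metis card_image)
qed

text \<open>A single count of left cosets that covers the three kinds of quotient in the Steinitz
  orders. For nonempty A, \<open>index G A K > 0\<close> says that there are finitely many
  cosets.\<close>

definition index :: "('a, 'b) monoid_scheme \<Rightarrow> 'a set \<Rightarrow> 'a set \<Rightarrow> nat" where
  "index G A K = card ((\<lambda>a. a <#\<^bsub>G\<^esub> K) ` A)"

context group
begin

lemma l_coset_eq_iff:
  assumes "subgroup K G" "a \<in> carrier G" "b \<in> carrier G"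
  shows "a <# K = b <# K \<longleftrightarrow> inv a \<otimes> b \<in> K"
proof
  assume "a <# K = b <# K"
  then have "b \<in> a <# K"
    using assms lcos_self by blast
  then show "inv a \<otimes> b \<in> K"
    by (rule subgroup.lcos_module_imp[OF assms(1) is_group assms(2)])
next
  assume "inv a \<otimes> b \<in> K"
  then have "b \<in> a <# K"
    by (rule subgroup.lcos_module_rev[OF assms(1) is_group assms(2,3)])
  then show "a <# K = b <# K"
    by (rule l_repr_independence[OF _ assms(2,1)])
qed

text \<open>A transversal of L in A identifies the pairs (bL, lK) with the cosets blK. Being a
  bijection, it also covers infinite indices, where \<open>card\<close> is 0 on both sides.\<close>

lemma index_tower:
  assumes A: "subgroup A G" and L: "subgroup L G" and K: "subgroup K G"
    and "K \<subseteq> L" "L \<subseteq> A"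
  shows "index G A K = index G A L * index G L K"
proof -
  have carr: "a \<in> carrier G" if "a \<in> A" for a
    using subgroup.mem_carrier[OF A that] .
  \<comment> \<open>The representative depends on the coset as a set and not on the element that
    names it, so \<open>?F\<close> below is a function of pairs of cosets.\<close>
  define r where "r c = (SOME b. b \<in> A \<and> b <# L = c)" for c
  have r: "r (a <# L) \<in> A" "r (a <# L) <# L = a <# L" if "a \<in> A" for a
  proof -
    have "r (a <# L) \<in> A \<and> r (a <# L) <# L = a <# L"
      unfolding r_def by (rule someI[of _ a]) (simp add: that)
    then show "r (a <# L) \<in> A" "r (a <# L) <# L = a <# L"
      by auto
  qed
  have sub: "K \<subseteq> carrier G" "L \<subseteq> carrier G"
    using subgroup.subset[OF K] subgroup.subset[OF L] .
  let ?F = "\<lambda>(c, d). (\<lambda>x. r c \<otimes> x) ` d"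
  have F: "?F (a <# L, l <# K) = (r (a <# L) \<otimes> l) <# K" if "a \<in> A" "l \<in> L" for a l
  proof -
    have "r (a <# L) \<in> carrier G" "l \<in> carrier G"
      using r(1)[OF that(1)] that sub carr by auto
    moreover have "?F (a <# L, l <# K) = r (a <# L) <# (l <# K)"
      by (auto simp: l_coset_def)
    ultimately show ?thesis
      using lcos_m_assoc[OF sub(1)] by simp
  qed
  have "bij_betw ?F (((\<lambda>a. a <# L) ` A) \<times> ((\<lambda>a. a <# K) ` L)) ((\<lambda>a. a <# K) ` A)"
    unfolding bij_betw_def
  proof
    have inj: "a <# L = a' <# L \<and> l <# K = l' <# K"
      if "a \<in> A" "a' \<in> A" "l \<in> L" "l' \<in> L"
        and eq: "?F (a <# L, l <# K) = ?F (a' <# L, l' <# K)" for a a' l l'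
    proof
      let ?b = "r (a <# L)" and ?b' = "r (a' <# L)"
      have c: "?b \<in> carrier G" "?b' \<in> carrier G" "l \<in> carrier G" "l' \<in> carrier G"
        using r that carr sub by auto
      have "inv (?b \<otimes> l) \<otimes> (?b' \<otimes> l') \<in> K"
        using eq that F c l_coset_eq_iff[OF K] by auto
      \<comment> \<open>This is used twice. Modulo L the factors l and l' cancel, so the two
        L-cosets agree and the chosen representatives coincide; with these removed, what remains
        says that l and l' lie in the same K-coset.\<close>
      then have *: "inv l \<otimes> (inv ?b \<otimes> ?b' \<otimes> l') \<in> K"
        using c by (simp add: inv_mult_group m_assoc)
      then have "l \<otimes> (inv l \<otimes> (inv ?b \<otimes> ?b' \<otimes> l')) \<otimes> inv l' \<in> L"
        using that \<open>K \<subseteq> L\<close> L by (meson subgroup.m_closed subgroup.m_inv_closed subsetD)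
      then have "inv ?b \<otimes> ?b' \<in> L"
        using c by (simp add: m_assoc[symmetric]) (simp add: m_assoc)
      then have "?b <# L = ?b' <# L"
        using l_coset_eq_iff[OF L] c by blast
      then show aa: "a <# L = a' <# L"
        using r that by auto
      show "l <# K = l' <# K"
        using * c that l_coset_eq_iff[OF K c(3,4)] unfolding aa
        by (simp add: m_assoc[symmetric])
    qed
    show "inj_on ?F (((\<lambda>a. a <# L) ` A) \<times> ((\<lambda>a. a <# K) ` L))"
    proof (rule inj_onI)
      fix x y
      assume "x \<in> ((\<lambda>a. a <# L) ` A) \<times> ((\<lambda>a. a <# K) ` L)"
        and "y \<in> ((\<lambda>a. a <# L) ` A) \<times> ((\<lambda>a. a <# K) ` L)" and eq: "?F x = ?F y"
      then obtain a l a' l' where al: "a \<in> A" "a' \<in> A" "l \<in> L" "l' \<in> L"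
        and xy: "x = (a <# L, l <# K)" "y = (a' <# L, l' <# K)"
        by blast
      show "x = y"
        using inj[OF al eq[unfolded xy]] xy by simp
    qed
    show "?F ` (((\<lambda>a. a <# L) ` A) \<times> ((\<lambda>a. a <# K) ` L)) = (\<lambda>a. a <# K) ` A"
    proof (intro equalityI subsetI)
      fix y assume "y \<in> ?F ` (((\<lambda>a. a <# L) ` A) \<times> ((\<lambda>a. a <# K) ` L))"
      then obtain a l where al: "a \<in> A" "l \<in> L" "y = ?F (a <# L, l <# K)"
        by blast
      then have "y = (r (a <# L) \<otimes> l) <# K"
        by (simp only: F)
      moreover have "r (a <# L) \<otimes> l \<in> A"
        by (rule subgroup.m_closed[OF A r(1)[OF al(1)] subsetD[OF \<open>L \<subseteq> A\<close> al(2)]])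
      ultimately show "y \<in> (\<lambda>a. a <# K) ` A"
        by blast
    next
      fix y assume "y \<in> (\<lambda>a. a <# K) ` A"
      then obtain a where a: "a \<in> A" "y = a <# K"
        by blast
      let ?b = "r (a <# L)"
      have b: "?b \<in> A" "inv ?b \<otimes> a \<in> L"
        using r[OF a(1)] l_coset_eq_iff[OF L] a carr by auto
      then have "y = ?F (a <# L, (inv ?b \<otimes> a) <# K)"
        using F[OF a(1) b(2)] a carr by (simp add: m_assoc[symmetric])
      then show "y \<in> ?F ` (((\<lambda>a. a <# L) ` A) \<times> ((\<lambda>a. a <# K) ` L))"
        using a b by blast
    qed
  qed
  then have "card (((\<lambda>a. a <# L) ` A) \<times> ((\<lambda>a. a <# K) ` L)) = card ((\<lambda>a. a <# K) ` A)"
    by (rule bij_betw_same_card)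
  then show ?thesis
    by (simp add: index_def card_cartesian_product)
qed

lemma subgroup_normal_mult:
  assumes "N \<lhd> G" "subgroup D G"
  shows "subgroup (N <#> D) G" "N \<subseteq> N <#> D" "D \<subseteq> N <#> D"
proof -
  interpret second_isomorphism_grp N G D
    using assms by (simp add: second_isomorphism_grp_axioms_def second_isomorphism_grp_def)
  show "subgroup (N <#> D) G" "N \<subseteq> N <#> D" "D \<subseteq> N <#> D"
    by (fact normal_set_mult_subgroup H_contained_in_set_mult S_contained_in_set_mult)+
qed

text \<open>The second isomorphism theorem for cosets: ndN = dN because N is normal, so D already
  meets every N-coset in ND, and two elements of D agree modulo N exactly when they agree modulo N
  \<inter> D.\<close>

lemma index_normal_mult:
  assumes N: "N \<lhd> G" and D: "subgroup D G"
  shows "index G (N <#> D) N = index G D (N \<inter> D)"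
proof -
  have sN: "subgroup N G"
    using N normal_imp_subgroup by blast
  have sND: "subgroup (N \<inter> D) G"
    using sN D by (rule subgroups_Inter_pair)
  have c: "n \<in> carrier G" if "n \<in> N \<union> D" for n
    using that sN D subgroup.subset by blast
  have "(n \<otimes> d) <# N = d <# N" if "n \<in> N" "d \<in> D" for n d
  proof -
    have "inv d \<otimes> inv n \<otimes> d \<in> N"
      using that c N normal.inv_op_closed1 sN subgroup.m_inv_closed by (metis UnI2)
    then show ?thesis
      using that c by (subst l_coset_eq_iff[OF sN]) (auto simp: inv_mult_group)
  qed
  then have "(\<lambda>a. a <# N) ` (N <#> D) \<subseteq> (\<lambda>a. a <# N) ` D"
    by (auto simp: set_mult_def)
  then have "(\<lambda>a. a <# N) ` (N <#> D) = (\<lambda>a. a <# N) ` D"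
    using subgroup_normal_mult(3)[OF N D] by blast
  moreover have "card ((\<lambda>a. a <# N) ` D) = card ((\<lambda>a. a <# (N \<inter> D)) ` D)"
  proof (rule card_image_cong_fibres)
    fix a b assume "a \<in> D" "b \<in> D"
    moreover from this have "inv a \<otimes> b \<in> D"
      using D subgroup.m_closed subgroup.m_inv_closed by metis
    ultimately show "a <# N = b <# N \<longleftrightarrow> a <# (N \<inter> D) = b <# (N \<inter> D)"
      using c by (simp add: l_coset_eq_iff sN sND)
  qed
  ultimately show ?thesis
    by (simp add: index_def)
qed

text \<open>\<open>Mod\<close> is made of right cosets while \<open>index\<close> counts left ones;
  normality identifies them.\<close>

lemma card_carrier_FactGroup:
  assumes "N \<lhd> G"
  shows "card (carrier (G Mod N)) = index G (carrier G) N"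
  unfolding carrier_FactGroup index_def
  using normal.coset_eq[OF assms] by (auto intro!: arg_cong[where f = card] image_cong)

lemma card_carrier_FactGroup_Int:
  assumes N: "N \<lhd> G" and D: "subgroup D G"
  shows "card (carrier (G\<lparr>carrier := D\<rparr> Mod (N \<inter> D))) = index G D (N \<inter> D)"
proof -
  interpret second_isomorphism_grp N G D
    using assms by (simp add: second_isomorphism_grp_axioms_def second_isomorphism_grp_def)
  have "D \<inter> N \<lhd> G\<lparr>carrier := D\<rparr>"
    by (rule normal_subgrp_intersection_normal)
  then have "N \<inter> D \<lhd> G\<lparr>carrier := D\<rparr>"
    by (simp add: Int_commute)
  from normal.coset_eq[OF this] show ?thesis
    unfolding carrier_FactGroup index_def
    by (auto intro!: arg_cong[where f = card] image_cong)
qed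

lemma card_lcosets: "card (lcosets H) = index G (carrier G) H"
  by (simp add: LCOSETS_def index_def UNION_singleton_eq_range)

end

text \<open>Whether two cosets of K coincide depends only on whether a^-1 b lies in K, and
  injectivity of \<psi> on the carrier lets this be tested after applying \<psi>.\<close>

lemma index_iso_image:
  assumes G: "group G" and G': "group G'" and \<psi>: "\<psi> \<in> iso G G'"
    and A: "A \<subseteq> carrier G" and K: "subgroup K G"
  shows "index G' (\<psi> ` A) (\<psi> ` K) = index G A K"
proof -
  interpret group_hom G G' \<psi>
    using assms by (simp add: group_hom.intro group_hom_axioms_def iso_imp_homomorphism)
  have inj: "inj_on \<psi> (carrier G)"
    using \<psi> by (auto simp: iso_def bij_betw_def)
  have K': "subgroup (\<psi> ` K) G'"
    using K by (rule subgroup_img_is_subgroup)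
  have "card ((\<lambda>a. \<psi> a <#\<^bsub>G'\<^esub> \<psi> ` K) ` A) = card ((\<lambda>a. a <#\<^bsub>G\<^esub> K) ` A)"
  proof (rule card_image_cong_fibres)
    fix a b assume ab: "a \<in> A" "b \<in> A"
    then have c: "a \<in> carrier G" "b \<in> carrier G"
      using A by auto
    then have "inv\<^bsub>G'\<^esub> (\<psi> a) \<otimes>\<^bsub>G'\<^esub> \<psi> b = \<psi> (inv\<^bsub>G\<^esub> a \<otimes>\<^bsub>G\<^esub> b)"
      by simp
    moreover have "\<psi> (inv\<^bsub>G\<^esub> a \<otimes>\<^bsub>G\<^esub> b) \<in> \<psi> ` K \<longleftrightarrow> inv\<^bsub>G\<^esub> a \<otimes>\<^bsub>G\<^esub> b \<in> K"
      using c by (intro inj_on_image_mem_iff[OF inj] subgroup.subset[OF K]) simp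
    ultimately show "\<psi> a <#\<^bsub>G'\<^esub> \<psi> ` K = \<psi> b <#\<^bsub>G'\<^esub> \<psi> ` K \<longleftrightarrow> a <#\<^bsub>G\<^esub> K = b <#\<^bsub>G\<^esub> K"
      using c K K' by (simp add: group.l_coset_eq_iff[OF G] group.l_coset_eq_iff[OF G'])
  qed
  then show ?thesis
    by (simp add: index_def image_image)
qed


section \<open>Steinitz orders of a family of normal subgroups\<close>

text \<open>Positivity matters: every multiplicity in 0 is 0, so a zero factor would erase the
  exponents of the other one.\<close>

lemma steinitz_of_nat_mult:
  assumes "a > 0" "b > 0"
  shows "steinitz_of_nat (a * b) = steinitz_of_nat a * steinitz_of_nat b"
proof (transfer fixing: a b, rule ext)
  fix p :: nat
  show "(if prime p then enat (multiplicity p (a * b)) else 0) =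
      (if prime p then enat (multiplicity p a) else 0) +
      (if prime p then enat (multiplicity p b) else 0)"
    using assms by (simp add: prime_elem_multiplicity_mult_distrib)
qed

lemma exponent_steinitz_of_nat_mono:
  assumes "a dvd b" "b > 0"
  shows "exponent (steinitz_of_nat a) p \<le> exponent (steinitz_of_nat b) p"
  using assms by (simp add: steinitz_of_nat.rep_eq dvd_imp_multiplicity_le)

text \<open>An infinite set of extended naturals has supremum \<infinity>, so a finite supremum is a
  maximum.\<close>

lemma enat_Sup_in:
  fixes A :: "enat set"
  assumes "A \<noteq> {}" "Sup A < \<infinity>"
  shows "Sup A \<in> A"
  using assms by (auto simp: Sup_enat_def split: if_splits)

text \<open>When both suprema are finite they are attained, at i and j say, and \<open>dir\<close>
  supplies one index k that serves both. When one is infinite, the supremum of the sums dominates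
  it. Without \<open>dir\<close> the identity fails: let f and g be the indicators of two different
  indices.\<close>

lemma SUP_add_directed_enat:
  fixes f g :: "'i \<Rightarrow> enat"
  assumes "I \<noteq> {}"
    and dir: "\<And>i j. i \<in> I \<Longrightarrow> j \<in> I \<Longrightarrow> \<exists>k\<in>I. f i \<le> f k \<and> g j \<le> g k"
  shows "(SUP i\<in>I. f i + g i) = (SUP i\<in>I. f i) + (SUP i\<in>I. g i)"
proof (rule antisym)
  show "(SUP i\<in>I. f i + g i) \<le> (SUP i\<in>I. f i) + (SUP i\<in>I. g i)"
    by (intro SUP_least add_mono SUP_upper)
  let ?S = "SUP i\<in>I. f i + g i"
  have le: "f i \<le> ?S" "g i \<le> ?S" if "i \<in> I" for i
    using order_trans[OF _ SUP_upper[of i I "\<lambda>i. f i + g i"]] that by auto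
  show "(SUP i\<in>I. f i) + (SUP i\<in>I. g i) \<le> ?S"
  proof (cases "(SUP i\<in>I. f i) < \<infinity> \<and> (SUP i\<in>I. g i) < \<infinity>")
    case True
    then obtain i j where ij: "i \<in> I" "j \<in> I" "(SUP i\<in>I. f i) = f i" "(SUP i\<in>I. g i) = g j"
      using enat_Sup_in[of "f ` I"] enat_Sup_in[of "g ` I"] \<open>I \<noteq> {}\<close>
      by (elim conjE) (auto elim!: imageE)
    then obtain k where k: "k \<in> I" "f i \<le> f k" "g j \<le> g k"
      using dir by blast
    then have "f i + g j \<le> f k + g k"
      by (simp add: add_mono)
    also have "\<dots> \<le> ?S"
      using k by (intro SUP_upper)
    finally show ?thesis
      using ij by simp
  next
    case False
    moreover have "(SUP i\<in>I. f i) \<le> ?S" "(SUP i\<in>I. g i) \<le> ?S"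
      using le by (auto intro: SUP_least)
    ultimately show ?thesis
      by auto
  qed
qed

lemma exponent_steinitz_LCM:
  "exponent (steinitz_LCM ((\<lambda>i. s i) ` I)) p = (SUP i\<in>I. exponent (s i) p)"
  by (simp add: steinitz_LCM.rep_eq image_image)

lemma steinitz_lagrange:
  fixes G (structure)
  assumes "group G" and D: "subgroup D G" and "\<N> \<noteq> {}"
    and normal: "\<And>N. N \<in> \<N> \<Longrightarrow> N \<lhd> G"
    and fin: "\<And>N. N \<in> \<N> \<Longrightarrow> index G (carrier G) N > 0"
    and Int: "\<And>N N'. N \<in> \<N> \<Longrightarrow> N' \<in> \<N> \<Longrightarrow> N \<inter> N' \<in> \<N>"
  shows "steinitz_LCM ((\<lambda>N. steinitz_of_nat (index G (carrier G) N)) ` \<N>) =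
    steinitz_LCM ((\<lambda>N. steinitz_of_nat (index G (carrier G) (N <#>\<^bsub>G\<^esub> D))) ` \<N>) *
    steinitz_LCM ((\<lambda>N. steinitz_of_nat (index G D (N \<inter> D))) ` \<N>)"
proof -
  interpret group G by fact
  let ?r = "\<lambda>N. index G (carrier G) (N <#> D)" and ?d = "\<lambda>N. index G D (N \<inter> D)"
  have split: "index G (carrier G) N = ?r N * ?d N" if "N \<in> \<N>" for N
    using index_tower[OF subgroup_self subgroup_normal_mult(1)[OF normal[OF that] D]
        normal_imp_subgroup[OF normal[OF that]] subgroup_normal_mult(2)[OF normal[OF that] D]]
      index_normal_mult[OF normal[OF that] D] subgroup.subset[OF subgroup_normal_mult(1)[OF normal[OF that] D]]
    by simp
  have pos: "?r N > 0" "?d N > 0" if "N \<in> \<N>" for N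
    using fin[OF that] split[OF that] by auto
  \<comment> \<open>Both claims are the tower formula, along N'D <= ND <= G and along N' \<inter> D
    <= N \<inter> D <= D: the index at the larger subgroup is a factor of the index at the smaller
    one.\<close>
  have mono: "?r N dvd ?r N'" "?d N dvd ?d N'" if "N \<in> \<N>" "N' \<in> \<N>" "N' \<subseteq> N" for N N'
  proof -
    note n = normal[OF that(1)] normal[OF that(2)]
    note s = subgroup_normal_mult(1)[OF n(1) D] subgroup_normal_mult(1)[OF n(2) D]
    show "?r N dvd ?r N'"
      using index_tower[OF subgroup_self s] subgroup.subset[OF s(1)] mono_set_mult[OF that(3) order_refl]
      by (metis dvd_triv_left)
    show "?d N dvd ?d N'"
      using index_tower[OF D subgroups_Inter_pair[OF normal_imp_subgroup[OF n(1)] D]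
          subgroups_Inter_pair[OF normal_imp_subgroup[OF n(2)] D]] that(3)
      by (metis Int_lower2 Int_mono dvd_triv_left order_refl)
  qed
  have "(SUP N\<in>\<N>. exponent (steinitz_of_nat (index G (carrier G) N)) p) =
      (SUP N\<in>\<N>. exponent (steinitz_of_nat (?r N)) p) +
      (SUP N\<in>\<N>. exponent (steinitz_of_nat (?d N)) p)"
    for p
  proof -
    have "(SUP N\<in>\<N>. exponent (steinitz_of_nat (index G (carrier G) N)) p) =
        (SUP N\<in>\<N>. exponent (steinitz_of_nat (?r N)) p + exponent (steinitz_of_nat (?d N)) p)"
      by (intro SUP_cong refl) (simp add: split steinitz_of_nat_mult pos times_steinitz.rep_eq)
    also have "\<dots> = (SUP N\<in>\<N>. exponent (steinitz_of_nat (?r N)) p) +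
        (SUP N\<in>\<N>. exponent (steinitz_of_nat (?d N)) p)"
    proof (rule SUP_add_directed_enat[OF \<open>\<N> \<noteq> {}\<close>])
      fix N N' assume "N \<in> \<N>" "N' \<in> \<N>"
      \<comment> \<open>The common index is N \<inter> N', which raises the first exponent from N
        and the second from N'.\<close>
      then show "\<exists>K\<in>\<N>. exponent (steinitz_of_nat (?r N)) p \<le> exponent (steinitz_of_nat (?r K)) p \<and>
          exponent (steinitz_of_nat (?d N')) p \<le> exponent (steinitz_of_nat (?d K)) p"
        using mono pos Int by (intro bexI[of _ "N \<inter> N'"] conjI exponent_steinitz_of_nat_mono) auto
    qed
    finally show ?thesis .
  qed
  then show ?thesis
    by (simp add: exponent_inject[symmetric] times_steinitz.rep_eq exponent_steinitz_LCM fun_eq_iff)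
qed

lemma steinitz_orders_iso_image:
  assumes G: "group G" and G': "group G'" and \<psi>: "\<psi> \<in> iso G G'"
    and D: "subgroup D G" and normal: "\<And>N. N \<in> \<N> \<Longrightarrow> N \<lhd> G"
  shows "(\<lambda>N. steinitz_of_nat (index G' (carrier G') N)) ` (`) \<psi> ` \<N> =
      (\<lambda>N. steinitz_of_nat (index G (carrier G) N)) ` \<N>"
    and "(\<lambda>N. steinitz_of_nat (index G' (carrier G') (N <#>\<^bsub>G'\<^esub> \<psi> ` D))) ` (`) \<psi> ` \<N> =
      (\<lambda>N. steinitz_of_nat (index G (carrier G) (N <#>\<^bsub>G\<^esub> D))) ` \<N>"
    and "(\<lambda>N. steinitz_of_nat (index G' (\<psi> ` D) (N \<inter> \<psi> ` D))) ` (`) \<psi> ` \<N> =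
      (\<lambda>N. steinitz_of_nat (index G D (N \<inter> D))) ` \<N>"
proof -
  have carr: "carrier G' = \<psi> ` carrier G" and inj: "inj_on \<psi> (carrier G)"
    using \<psi> by (auto simp: iso_def bij_betw_def)
  note D' = subgroup.subset[OF D]
  have N: "subgroup N G" "N \<subseteq> carrier G" if "N \<in> \<N>" for N
    using normal[OF that] normal_imp_subgroup subgroup.subset by blast+
  note idx = index_iso_image[OF G G' \<psi>]
  show "(\<lambda>N. steinitz_of_nat (index G' (carrier G') N)) ` (`) \<psi> ` \<N> =
      (\<lambda>N. steinitz_of_nat (index G (carrier G) N)) ` \<N>"
    unfolding image_image carr by (intro image_cong refl) (simp add: idx N)
  have mult: "\<psi> ` N <#>\<^bsub>G'\<^esub> \<psi> ` D = \<psi> ` (N <#>\<^bsub>G\<^esub> D)" if "N \<in> \<N>" for N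
    using set_mult_hom[OF _ N(2)[OF that] D', of \<psi> G'] \<psi> by (simp add: iso_def)
  show "(\<lambda>N. steinitz_of_nat (index G' (carrier G') (N <#>\<^bsub>G'\<^esub> \<psi> ` D))) ` (`) \<psi> ` \<N> =
      (\<lambda>N. steinitz_of_nat (index G (carrier G) (N <#>\<^bsub>G\<^esub> D))) ` \<N>"
    unfolding image_image carr
    by (intro image_cong refl) (simp add: mult idx group.subgroup_normal_mult[OF G] normal D)
  show "(\<lambda>N. steinitz_of_nat (index G' (\<psi> ` D) (N \<inter> \<psi> ` D))) ` (`) \<psi> ` \<N> =
      (\<lambda>N. steinitz_of_nat (index G D (N \<inter> D))) ` \<N>"
    unfolding image_image
    by (intro image_cong refl)
      (simp add: inj_on_image_Int[OF inj N(2) D', symmetric] idx D' group.subgroups_Inter_pair[OF G N(1) D])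
qed


section \<open>The closure group of an equicontinuous action\<close>

locale equicontinuous_cantor =
  fixes m :: "'x metric" and \<Gamma> :: "('g, 'c) monoid_scheme" and \<phi> :: "'g \<Rightarrow> 'x \<Rightarrow> 'x"
  assumes action: "equicontinuous_cantor_action m \<Gamma> \<phi>"
begin

abbreviation "M \<equiv> mspace m"
abbreviation "d \<equiv> mdist m"
abbreviation "X \<equiv> mtopology_of m"
abbreviation "GG \<equiv> closure_group m \<Gamma> \<phi>"

sublocale Metric_space M d
  by (rule Metric_space_mspace_mdist)

lemma X_eq: "X = mtopology"
  by (simp add: mtopology_of_def)

sublocale group_action \<Gamma> M \<phi>
  using action by (simp add: equicontinuous_cantor_action_def cantor_action_def)

sublocale \<Gamma>: group \<Gamma>
  using group_hom by (simp add: group_hom_def)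

lemma compact_X: "compact_space X"
proof -
  have "compact_space (product_topology (\<lambda>_::nat. discrete_topology (UNIV :: bool set)) UNIV)"
    by (simp add: compact_space_product_topology compact_space_discrete_topology)
  then show ?thesis
    using action homeomorphic_compact_space
    by (auto simp: equicontinuous_cantor_action_def cantor_action_def cantor_space_def)
qed

lemma M_nonempty: "M \<noteq> {}"
proof -
  have "topspace (product_topology (\<lambda>_::nat. discrete_topology (UNIV :: bool set)) UNIV) \<noteq> {}"
    by simp
  moreover have "X homeomorphic_space product_topology (\<lambda>_::nat. discrete_topology (UNIV :: bool set)) UNIV"
    using action by (simp add: equicontinuous_cantor_action_def cantor_action_def cantor_space_def)
  ultimately show ?thesis
    by (metis homeomorphic_empty_space null_topspace_iff_trivial topspace_mtopology_of)
qed

section \<open>Metric consequences of compactness and equicontinuity\<close>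

lemma totally_bounded_M: "mtotally_bounded M"
  using compact_X by (simp add: X_eq compact_space_eq_mcomplete_mtotally_bounded)

lemma complete_M: "mcomplete"
  using compact_X by (simp add: X_eq compact_space_eq_mcomplete_mtotally_bounded)

lemma finite_ball_cover:
  assumes "\<epsilon> > 0"
  obtains F where "finite F" "F \<subseteq> M" "\<And>x. x \<in> M \<Longrightarrow> \<exists>p\<in>F. d p x < \<epsilon>"
proof -
  obtain F where "finite F" "F \<subseteq> M" "M \<subseteq> (\<Union>p\<in>F. mball p \<epsilon>)"
    using totally_bounded_M[unfolded mtotally_bounded_def, rule_format, OF assms] by auto
  moreover from this(3) have "\<exists>p\<in>F. d p x < \<epsilon>" if "x \<in> M" for x
    using that by (auto dest!: subsetD)
  ultimately show thesis
    using that by simp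
qed

lemma equicontinuous:
  assumes "\<epsilon> > 0"
  obtains \<delta> where "\<delta> > 0"
    "\<And>g x y. g \<in> carrier \<Gamma> \<Longrightarrow> x \<in> M \<Longrightarrow> y \<in> M \<Longrightarrow> d x y < \<delta> \<Longrightarrow> d (\<phi> g x) (\<phi> g y) < \<epsilon>"
  using action assms unfolding equicontinuous_cantor_action_def equicontinuous_action_def by meson

lemma phi_Bij: "g \<in> carrier \<Gamma> \<Longrightarrow> \<phi> g \<in> Bij M"
  using group_hom group_hom.hom_closed by (fastforce simp: BijGroup_def)

lemma phi_in [simp]: "g \<in> carrier \<Gamma> \<Longrightarrow> x \<in> M \<Longrightarrow> \<phi> g x \<in> M"
  by (rule element_image) auto

lemma phi_mult:
  assumes "g \<in> carrier \<Gamma>" "h \<in> carrier \<Gamma>" "x \<in> M"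
  shows "\<phi> (g \<otimes>\<^bsub>\<Gamma>\<^esub> h) x = \<phi> g (\<phi> h x)"
  using assms by (simp add: composition_rule)

lemma phi_inv:
  assumes "g \<in> carrier \<Gamma>" "x \<in> M"
  shows "\<phi> (inv\<^bsub>\<Gamma>\<^esub> g) (\<phi> g x) = x" "\<phi> g (\<phi> (inv\<^bsub>\<Gamma>\<^esub> g) x) = x"
proof -
  have "\<phi> \<one>\<^bsub>\<Gamma>\<^esub> x = x"
    using assms id_eq_one by (metis restrict_apply')
  then show "\<phi> (inv\<^bsub>\<Gamma>\<^esub> g) (\<phi> g x) = x" "\<phi> g (\<phi> (inv\<^bsub>\<Gamma>\<^esub> g) x) = x"
    using assms by (simp_all flip: phi_mult)
qed

text \<open>Uniform limits of the action, formulated for arbitrary self-maps of M, so that limits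
  and inverses can be tested before they are known to be homeomorphisms.\<close>

definition approximable :: "('x \<Rightarrow> 'x) \<Rightarrow> bool" where
  "approximable f \<longleftrightarrow> (\<forall>x\<in>M. f x \<in> M) \<and>
     (\<forall>\<epsilon>>0. \<exists>g\<in>carrier \<Gamma>. \<forall>x\<in>M. d (f x) (\<phi> g x) < \<epsilon>)"

lemma approximable_in: "approximable f \<Longrightarrow> x \<in> M \<Longrightarrow> f x \<in> M"
  by (simp add: approximable_def)

lemma approximableE:
  assumes "approximable f" "\<epsilon> > 0"
  obtains g where "g \<in> carrier \<Gamma>" "\<And>x. x \<in> M \<Longrightarrow> d (f x) (\<phi> g x) < \<epsilon>"
  using assms by (auto simp: approximable_def)

text \<open>The \<delta> that belongs to \<epsilon>/3 for \<Gamma> works for every uniform limit;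
  the other two thirds pay for replacing f by some \<open>\<phi> g\<close> at x and at y.\<close>

lemma approximable_equicontinuous:
  assumes "\<epsilon> > 0"
  obtains \<delta> where "\<delta> > 0"
    "\<And>f x y. approximable f \<Longrightarrow> x \<in> M \<Longrightarrow> y \<in> M \<Longrightarrow> d x y < \<delta> \<Longrightarrow> d (f x) (f y) < \<epsilon>"
proof -
  obtain \<delta> where \<delta>: "\<delta> > 0"
    "\<And>g x y. g \<in> carrier \<Gamma> \<Longrightarrow> x \<in> M \<Longrightarrow> y \<in> M \<Longrightarrow> d x y < \<delta> \<Longrightarrow> d (\<phi> g x) (\<phi> g y) < \<epsilon>/3"
    using equicontinuous[of "\<epsilon>/3"] assms by auto
  have "d (f x) (f y) < \<epsilon>" if f: "approximable f" and xy: "x \<in> M" "y \<in> M" "d x y < \<delta>" for f x y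
  proof -
    obtain g where g: "g \<in> carrier \<Gamma>" "\<And>x. x \<in> M \<Longrightarrow> d (f x) (\<phi> g x) < \<epsilon>/3"
      using approximableE[OF f, of "\<epsilon>/3"] assms by auto
    have in_M: "f x \<in> M" "f y \<in> M" "\<phi> g x \<in> M" "\<phi> g y \<in> M"
      using approximable_in[OF f] g xy by auto
    have "d (f x) (f y) \<le> d (f x) (\<phi> g x) + d (\<phi> g x) (\<phi> g y) + d (f y) (\<phi> g y)"
      using triangle[of "f x" "\<phi> g x" "f y"] triangle[of "\<phi> g x" "\<phi> g y" "f y"] in_M
      by (simp add: commute[of "f y"])
    then show ?thesis
      using g(2)[OF xy(1)] g(2)[OF xy(2)] \<delta>(2)[OF g(1) xy] by linarith
  qed
  then show thesis
    using that \<delta>(1) by blast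
qed

lemma approximable_continuous: "approximable f \<Longrightarrow> continuous_map X X f"
proof (rule uniformly_continuous_imp_continuous_map)
  assume f: "approximable f"
  show "uniformly_continuous_map m m f"
    unfolding uniformly_continuous_map_def
  proof (intro conjI allI impI)
    show "f \<in> M \<rightarrow> M"
      using approximable_in[OF f] by auto
    fix \<epsilon> :: real assume "\<epsilon> > 0"
    then show "\<exists>\<delta>>0. \<forall>x\<in>M. \<forall>y\<in>M. d y x < \<delta> \<longrightarrow> d (f y) (f x) < \<epsilon>"
      using approximable_equicontinuous f by metis
  qed
qed

lemma phi_approximable: "g \<in> carrier \<Gamma> \<Longrightarrow> approximable (\<phi> g)"
  by (auto simp: approximable_def intro!: bexI[of _ g])

text \<open>A continuous bijection from a compact space to a Hausdorff space is a
  homeomorphism.\<close>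

lemma approximable_Bij_homeos:
  assumes "approximable f" "f \<in> Bij M"
  shows "f \<in> homeos X"
proof -
  have "homeomorphic_map X X f"
    using assms compact_X Hausdorff_space_mtopology
    by (intro continuous_imp_homeomorphic_map approximable_continuous)
      (auto simp: Bij_def bij_betw_def X_eq)
  then show ?thesis
    using assms by (simp add: homeos_def Bij_def)
qed

lemma homeos_Bij: "f \<in> homeos X \<Longrightarrow> f \<in> Bij M"
  using homeomorphic_imp_injective_map[of X X f] homeomorphic_imp_surjective_map[of X X f]
  by (simp add: homeos_def Bij_def bij_betw_def)

sublocale U: Metric_space "homeos X" "sup_dist m"
  by (rule Metric_space_sup_dist[OF compact_X M_nonempty])

text \<open>A real \<open>SUP\<close> is an upper bound only for a bounded family; total boundedness
  of M supplies the bound.\<close>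

lemma dist_le_sup_dist:
  assumes "f \<in> homeos X" "g \<in> homeos X" "x \<in> M"
  shows "d (f x) (g x) \<le> sup_dist m f g"
proof -
  have "mbounded M"
    using totally_bounded_M by (rule mtotally_bounded_imp_mbounded)
  then obtain B where B: "\<And>x y. x \<in> M \<Longrightarrow> y \<in> M \<Longrightarrow> d x y \<le> B"
    using mbounded_alt[of M] by blast
  have "f \<in> M \<rightarrow> M" "g \<in> M \<rightarrow> M"
    using assms homeos_Bij Bij_imp_funcset by blast+
  then have "bdd_above ((\<lambda>x. d (f x) (g x)) ` M)"
    by (intro bdd_aboveI2[of _ _ B]) (auto intro!: B)
  then show ?thesis
    using cSUP_upper[OF assms(3)] assms(1,2) by (simp add: sup_dist_def)
qed

lemma sup_dist_le:
  assumes "f \<in> homeos X" "g \<in> homeos X" "\<And>x. x \<in> M \<Longrightarrow> d (f x) (g x) \<le> \<epsilon>"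
  shows "sup_dist m f g \<le> \<epsilon>"
  using assms M_nonempty by (simp add: sup_dist_def cSUP_least)

lemma phi_homeos: "g \<in> carrier \<Gamma> \<Longrightarrow> \<phi> g \<in> homeos X"
  by (simp add: approximable_Bij_homeos phi_approximable phi_Bij)

text \<open>The closure is taken among homeomorphisms, but a bijection that is a uniform limit of
  the action is automatically one. This replaces \<open>sup_dist\<close> by estimates at single
  points.\<close>

lemma mem_GG: "f \<in> carrier GG \<longleftrightarrow> f \<in> Bij M \<and> approximable f"
proof -
  have "f \<in> carrier GG \<longleftrightarrow>
      f \<in> homeos X \<and> (\<forall>r>0. \<exists>g\<in>carrier \<Gamma>. \<phi> g \<in> homeos X \<and> sup_dist m f (\<phi> g) < r)"
    by (auto simp: closure_group_def uniform_topology_def U.metric_closure_of)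
  also have "\<dots> \<longleftrightarrow> f \<in> Bij M \<and> approximable f"
  proof (intro iffI conjI)
    assume L: "f \<in> homeos X \<and> (\<forall>r>0. \<exists>g\<in>carrier \<Gamma>. \<phi> g \<in> homeos X \<and> sup_dist m f (\<phi> g) < r)"
    then show fB: "f \<in> Bij M"
      using homeos_Bij by blast
    show "approximable f"
      unfolding approximable_def
    proof (intro conjI allI impI)
      show "\<forall>x\<in>M. f x \<in> M"
        using Bij_imp_funcset[OF fB] by blast
      fix \<epsilon> :: real assume "\<epsilon> > 0"
      then obtain g where "g \<in> carrier \<Gamma>" "\<phi> g \<in> homeos X" "sup_dist m f (\<phi> g) < \<epsilon>"
        using L by blast
      then show "\<exists>g\<in>carrier \<Gamma>. \<forall>x\<in>M. d (f x) (\<phi> g x) < \<epsilon>"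
        using dist_le_sup_dist L by (intro bexI[of _ g]) (auto intro: le_less_trans)
    qed
  next
    assume R: "f \<in> Bij M \<and> approximable f"
    then show f: "f \<in> homeos X"
      by (simp add: approximable_Bij_homeos)
    show "\<forall>r>0. \<exists>g\<in>carrier \<Gamma>. \<phi> g \<in> homeos X \<and> sup_dist m f (\<phi> g) < r"
    proof (intro allI impI)
      fix r :: real assume "r > 0"
      \<comment> \<open>A supremum of numbers below r/2 is only known to be at most r/2, hence the
        halving before a strict bound by r.\<close>
      then obtain g where g: "g \<in> carrier \<Gamma>" "\<And>x. x \<in> M \<Longrightarrow> d (f x) (\<phi> g x) < r/2"
        using R approximableE[of f "r/2"] by auto
      then have "sup_dist m f (\<phi> g) \<le> r/2"
        using f phi_homeos by (intro sup_dist_le) (auto intro: less_imp_le)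
      then show "\<exists>g\<in>carrier \<Gamma>. \<phi> g \<in> homeos X \<and> sup_dist m f (\<phi> g) < r"
        using g phi_homeos \<open>r > 0\<close> by (intro bexI[of _ g]) auto
    qed
  qed
  finally show ?thesis .
qed

section \<open>The group structure of the closure\<close>

lemma GG_in: "f \<in> carrier GG \<Longrightarrow> x \<in> M \<Longrightarrow> f x \<in> M"
  using approximable_in by (simp add: mem_GG)

lemma phi_GG: "g \<in> carrier \<Gamma> \<Longrightarrow> \<phi> g \<in> carrier GG"
  by (simp add: mem_GG phi_Bij phi_approximable)

lemma GG_mult:
  assumes "f \<in> carrier GG" "g \<in> carrier GG"
  shows "f \<otimes>\<^bsub>GG\<^esub> g = compose M f g"
  using assms unfolding mem_GG by (simp add: closure_group_def BijGroup_def)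

lemma GG_one: "\<one>\<^bsub>GG\<^esub> = (\<lambda>x\<in>M. x)"
  by (simp add: closure_group_def BijGroup_def)

text \<open>f (g x) is compared with a (g x) and then with a (b x). The second comparison passes
  through a, and equicontinuity bounds its effect by a \<delta> that is fixed before a and
  b.\<close>

lemma compose_approximable:
  assumes f: "approximable f" and g: "approximable g"
  shows "approximable (compose M f g)"
  unfolding approximable_def
proof (intro conjI allI impI)
  show "\<forall>x\<in>M. compose M f g x \<in> M"
    using approximable_in f g by (simp add: compose_eq)
  fix \<epsilon> :: real assume "\<epsilon> > 0"
  obtain \<delta> where \<delta>: "\<delta> > 0"
    "\<And>g x y. g \<in> carrier \<Gamma> \<Longrightarrow> x \<in> M \<Longrightarrow> y \<in> M \<Longrightarrow> d x y < \<delta> \<Longrightarrow> d (\<phi> g x) (\<phi> g y) < \<epsilon>/2"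
    using equicontinuous[of "\<epsilon>/2"] \<open>\<epsilon> > 0\<close> by auto
  obtain a where a: "a \<in> carrier \<Gamma>" "\<And>x. x \<in> M \<Longrightarrow> d (f x) (\<phi> a x) < \<epsilon>/2"
    using approximableE[OF f, of "\<epsilon>/2"] \<open>\<epsilon> > 0\<close> by auto
  obtain b where b: "b \<in> carrier \<Gamma>" "\<And>x. x \<in> M \<Longrightarrow> d (g x) (\<phi> b x) < \<delta>"
    using approximableE[OF g \<delta>(1)] by auto
  have "d (f (g x)) (\<phi> (a \<otimes>\<^bsub>\<Gamma>\<^esub> b) x) < \<epsilon>" if "x \<in> M" for x
  proof -
    have gx: "g x \<in> M"
      using approximable_in[OF g that] .
    have "d (f (g x)) (\<phi> a (\<phi> b x)) \<le> d (f (g x)) (\<phi> a (g x)) + d (\<phi> a (g x)) (\<phi> a (\<phi> b x))"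
      using triangle approximable_in[OF f gx] gx that a b by simp
    also have "\<dots> < \<epsilon>"
      using a(2)[OF gx] \<delta>(2)[OF a(1) gx _ b(2)[OF that]] that b(1) by simp
    finally show ?thesis
      using that a b by (simp add: phi_mult)
  qed
  then show "\<exists>g'\<in>carrier \<Gamma>. \<forall>x\<in>M. d (compose M f g x) (\<phi> g' x) < \<epsilon>"
    using a(1) b(1) by (intro bexI[of _ "a \<otimes>\<^bsub>\<Gamma>\<^esub> b"]) (auto simp: compose_eq)
qed

text \<open>If a is close to f, then a maps f' x close to f (f' x) = x, and applying the inverse of
  a shows that f' x is close to a^-1 x. As a is chosen after \<delta>, this needs a modulus of
  continuity common to all of \<Gamma>.\<close>

lemma inverse_approximable:
  assumes f: "approximable f" and in_M: "\<And>x. x \<in> M \<Longrightarrow> f' x \<in> M"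
    and inverse: "\<And>x. x \<in> M \<Longrightarrow> f (f' x) = x"
  shows "approximable f'"
  unfolding approximable_def
proof (intro conjI allI impI)
  show "\<forall>x\<in>M. f' x \<in> M"
    using in_M by blast
  fix \<epsilon> :: real assume "\<epsilon> > 0"
  then obtain \<delta> where \<delta>: "\<delta> > 0"
    "\<And>g x y. g \<in> carrier \<Gamma> \<Longrightarrow> x \<in> M \<Longrightarrow> y \<in> M \<Longrightarrow> d x y < \<delta> \<Longrightarrow> d (\<phi> g x) (\<phi> g y) < \<epsilon>"
    using equicontinuous by metis
  obtain a where a: "a \<in> carrier \<Gamma>" "\<And>x. x \<in> M \<Longrightarrow> d (f x) (\<phi> a x) < \<delta>"
    using approximableE[OF f \<delta>(1)] by auto
  have "d (f' x) (\<phi> (inv\<^bsub>\<Gamma>\<^esub> a) x) < \<epsilon>" if "x \<in> M" for x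
  proof -
    have "d (\<phi> a (f' x)) x < \<delta>"
      using a(2)[OF in_M[OF that]] inverse[OF that] by (simp add: commute)
    then have "d (\<phi> (inv\<^bsub>\<Gamma>\<^esub> a) (\<phi> a (f' x))) (\<phi> (inv\<^bsub>\<Gamma>\<^esub> a) x) < \<epsilon>"
      using \<delta>(2) a(1) in_M that by simp
    then show ?thesis
      using a(1) in_M that by (simp add: phi_inv)
  qed
  then show "\<exists>g\<in>carrier \<Gamma>. \<forall>x\<in>M. d (f' x) (\<phi> g x) < \<epsilon>"
    using a(1) by (intro bexI[of _ "inv\<^bsub>\<Gamma>\<^esub> a"]) auto
qed

sublocale GG: group GG
proof -
  have "subgroup (carrier GG) (BijGroup M)"
  proof (rule group.subgroupI[OF group_BijGroup])
    show "carrier GG \<subseteq> carrier (BijGroup M)"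
      by (auto simp: mem_GG BijGroup_def)
    show "carrier GG \<noteq> {}"
      using phi_GG by blast
    show "inv\<^bsub>BijGroup M\<^esub> f \<in> carrier GG" if "f \<in> carrier GG" for f
    proof -
      have f: "f \<in> Bij M" "approximable f"
        using that by (auto simp: mem_GG)
      then have "f ` M = M"
        by (simp add: Bij_def bij_betw_def)
      then have "approximable (\<lambda>x\<in>M. inv_into M f x)"
        by (intro inverse_approximable[OF f(2)]) (simp_all add: inv_into_into f_inv_into_f)
      then show ?thesis
        by (simp add: mem_GG inv_BijGroup f restrict_inv_into_Bij)
    qed
    show "f \<otimes>\<^bsub>BijGroup M\<^esub> g \<in> carrier GG" if "f \<in> carrier GG" "g \<in> carrier GG" for f g
      using that by (simp add: mem_GG BijGroup_def compose_Bij compose_approximable)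
  qed
  then have "group ((BijGroup M)\<lparr>carrier := carrier GG\<rparr>)"
    by (rule subgroup.subgroup_is_group[OF _ group_BijGroup])
  then show "group GG"
    by (simp add: closure_group_def)
qed

lemma GG_mult_apply:
  assumes "f \<in> carrier GG" "g \<in> carrier GG" "x \<in> M"
  shows "(f \<otimes>\<^bsub>GG\<^esub> g) x = f (g x)"
  using assms by (simp add: GG_mult compose_eq)

lemma GG_inv_apply:
  assumes "f \<in> carrier GG" "x \<in> M"
  shows "(inv\<^bsub>GG\<^esub> f) (f x) = x" "f ((inv\<^bsub>GG\<^esub> f) x) = x"
  using assms GG_mult_apply[of "inv\<^bsub>GG\<^esub> f" f x] GG_mult_apply[of f "inv\<^bsub>GG\<^esub> f" x]
  by (simp_all add: GG_one)

lemma GG_equicontinuous: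
  assumes "\<epsilon> > 0"
  obtains \<delta> where "\<delta> > 0"
    "\<And>f x y. f \<in> carrier GG \<Longrightarrow> x \<in> M \<Longrightarrow> y \<in> M \<Longrightarrow> d x y < \<delta> \<Longrightarrow> d (f x) (f y) < \<epsilon>"
  using approximable_equicontinuous[OF assms] mem_GG by metis

section \<open>Isotropy groups, open normal subgroups and transitivity\<close>

lemma discriminant_subgroup:
  assumes "x \<in> M"
  shows "subgroup (discriminant m \<Gamma> \<phi> x) GG"
proof (rule GG.subgroupI)
  show "discriminant m \<Gamma> \<phi> x \<noteq> {}"
    using assms GG.one_closed by (auto simp: discriminant_def stabilizer_def GG_one)
  show "inv\<^bsub>GG\<^esub> f \<in> discriminant m \<Gamma> \<phi> x" if "f \<in> discriminant m \<Gamma> \<phi> x" for f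
    using that GG_inv_apply(1)[of f x] assms by (auto simp: discriminant_def stabilizer_def)
qed (use assms in \<open>auto simp: discriminant_def stabilizer_def GG_mult_apply\<close>)

text \<open>The uniform distance is right invariant, so a subgroup is open as soon as it contains a
  neighbourhood of the identity.\<close>

lemma open_normal_subgroups_iff:
  "N \<in> open_normal_subgroups m \<Gamma> \<phi> \<longleftrightarrow>
     N \<lhd> GG \<and> (\<exists>\<epsilon>>0. \<forall>f\<in>carrier GG. (\<forall>x\<in>M. d (f x) x < \<epsilon>) \<longrightarrow> f \<in> N)"
proof -
  have hom: "f \<in> homeos X" if "f \<in> carrier GG" for f
    using that by (simp add: mem_GG approximable_Bij_homeos)
  have "openin (subtopology (uniform_topology m) (carrier GG)) N \<longleftrightarrow>
      (\<exists>\<epsilon>>0. \<forall>f\<in>carrier GG. (\<forall>x\<in>M. d (f x) x < \<epsilon>) \<longrightarrow> f \<in> N)" if N: "N \<lhd> GG"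
  proof
    have sN: "subgroup N GG"
      using N by (rule normal_imp_subgroup)
    show "\<exists>\<epsilon>>0. \<forall>f\<in>carrier GG. (\<forall>x\<in>M. d (f x) x < \<epsilon>) \<longrightarrow> f \<in> N"
      if opn: "openin (subtopology (uniform_topology m) (carrier GG)) N"
    proof -
      obtain T where T: "openin U.mtopology T" "N = T \<inter> carrier GG"
        using opn unfolding uniform_topology_def openin_subtopology by blast
      have "\<one>\<^bsub>GG\<^esub> \<in> T"
        using T subgroup.one_closed[OF sN] by blast
      then obtain r where r: "r > 0" "U.mball \<one>\<^bsub>GG\<^esub> r \<subseteq> T"
        using T by (auto simp: U.openin_mtopology)
      have "f \<in> N" if f: "f \<in> carrier GG" "\<forall>x\<in>M. d (f x) x < r/2" for f
      proof -
        have "sup_dist m \<one>\<^bsub>GG\<^esub> f \<le> r/2"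
          using f hom by (intro sup_dist_le) (auto simp: GG_one[symmetric] hom, auto simp: GG_one commute intro: less_imp_le)
        then have "f \<in> U.mball \<one>\<^bsub>GG\<^esub> r"
          using f(1) r(1) hom by simp
        then show ?thesis
          using r T f by blast
      qed
      then show ?thesis
        using r(1) by (intro exI[of _ "r/2"]) auto
    qed
    show "openin (subtopology (uniform_topology m) (carrier GG)) N"
      if ex: "\<exists>\<epsilon>>0. \<forall>f\<in>carrier GG. (\<forall>x\<in>M. d (f x) x < \<epsilon>) \<longrightarrow> f \<in> N"
    proof -
      obtain \<epsilon> where \<epsilon>: "\<epsilon> > 0" "\<And>f. f \<in> carrier GG \<Longrightarrow> (\<And>x. x \<in> M \<Longrightarrow> d (f x) x < \<epsilon>) \<Longrightarrow> f \<in> N"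
        using ex by blast
      have N_sub: "N \<subseteq> carrier GG"
        by (rule subgroup.subset[OF sN])
      \<comment> \<open>Balls are taken around all elements of N, so that the trace of
        \<open>?T\<close> on the group is N itself.\<close>
      let ?T = "\<Union>g\<in>N. U.mball g \<epsilon>"
      have absorb: "f \<in> N" if g: "g \<in> N" and f: "f \<in> carrier GG" and dist: "sup_dist m g f < \<epsilon>" for f g
      proof -
        have gG: "g \<in> carrier GG"
          using g N_sub by blast
        have "d ((f \<otimes>\<^bsub>GG\<^esub> inv\<^bsub>GG\<^esub> g) x) x < \<epsilon>" if "x \<in> M" for x
        proof -
          \<comment> \<open>Since x = g \<open>?y\<close>, the displacement of x under f g^-1 is the
            distance of f \<open>?y\<close> from g \<open>?y\<close>, one of the values that
            \<open>sup_dist m g f\<close> bounds.\<close>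
          let ?y = "(inv\<^bsub>GG\<^esub> g) x"
          have y: "?y \<in> M"
            using gG that by (simp add: GG_in)
          have "d (f ?y) (g ?y) < \<epsilon>"
            using dist_le_sup_dist[OF hom[OF gG] hom[OF f] y] dist by (simp add: commute)
          then show ?thesis
            using gG f that by (simp add: GG_mult_apply GG_inv_apply)
        qed
        then have "f \<otimes>\<^bsub>GG\<^esub> inv\<^bsub>GG\<^esub> g \<in> N"
          using \<epsilon>(2) f gG by simp
        then have "f \<otimes>\<^bsub>GG\<^esub> inv\<^bsub>GG\<^esub> g \<otimes>\<^bsub>GG\<^esub> g \<in> N"
          using g by (rule subgroup.m_closed[OF sN])
        then show ?thesis
          using f gG by (simp add: GG.m_assoc)
      qed
      have "N = ?T \<inter> carrier GG"
      proof (intro equalityI subsetI)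
        fix f assume f: "f \<in> N"
        then have "f \<in> U.mball f \<epsilon>"
          using hom[OF subsetD[OF N_sub f]] \<epsilon>(1) by simp
        then show "f \<in> ?T \<inter> carrier GG"
          using f N_sub by blast
      next
        fix f assume "f \<in> ?T \<inter> carrier GG"
        then show "f \<in> N"
          using absorb by auto
      qed
      moreover have "openin U.mtopology ?T"
        by (intro openin_Union) auto
      ultimately show ?thesis
        unfolding openin_subtopology uniform_topology_def by blast
    qed
  qed
  then show ?thesis
    by (auto simp: open_normal_subgroups_def)
qed

lemma open_normal_subgroups_nonempty: "open_normal_subgroups m \<Gamma> \<phi> \<noteq> {}"
proof -
  have "carrier GG \<lhd> GG"
    by (simp add: GG.normal_inv_iff GG.subgroup_self)
  then show ?thesis
    using open_normal_subgroups_iff[of "carrier GG"] zero_less_one by blast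
qed

lemma open_normal_subgroups_Int:
  assumes "N \<in> open_normal_subgroups m \<Gamma> \<phi>" "N' \<in> open_normal_subgroups m \<Gamma> \<phi>"
  shows "N \<inter> N' \<in> open_normal_subgroups m \<Gamma> \<phi>"
proof -
  obtain \<epsilon> where \<epsilon>: "\<epsilon> > 0" "\<And>f. f \<in> carrier GG \<Longrightarrow> (\<And>x. x \<in> M \<Longrightarrow> d (f x) x < \<epsilon>) \<Longrightarrow> f \<in> N"
    using assms(1) unfolding open_normal_subgroups_iff by blast
  obtain \<epsilon>' where \<epsilon>': "\<epsilon>' > 0" "\<And>f. f \<in> carrier GG \<Longrightarrow> (\<And>x. x \<in> M \<Longrightarrow> d (f x) x < \<epsilon>') \<Longrightarrow> f \<in> N'"
    using assms(2) unfolding open_normal_subgroups_iff by blast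
  have "N \<inter> N' \<lhd> GG"
    using assms GG.normal_subgroup_intersect unfolding open_normal_subgroups_iff by blast
  then show ?thesis
    unfolding open_normal_subgroups_iff using \<epsilon> \<epsilon>' by (intro conjI exI[of _ "min \<epsilon> \<epsilon>'"]) auto
qed

text \<open>The total boundedness half of Arzela-Ascoli: each g is encoded by its rounded values on
  a finite net, there are finitely many codes, and elements with the same code are uniformly
  close.\<close>

lemma finite_net:
  assumes "\<epsilon> > 0"
  obtains K where "finite K" "K \<subseteq> carrier \<Gamma>"
    "\<And>g. g \<in> carrier \<Gamma> \<Longrightarrow> \<exists>k\<in>K. \<forall>x\<in>M. d (\<phi> g x) (\<phi> k x) < \<epsilon>"
proof -
  obtain \<delta> where \<delta>: "\<delta> > 0"
    "\<And>g x y. g \<in> carrier \<Gamma> \<Longrightarrow> x \<in> M \<Longrightarrow> y \<in> M \<Longrightarrow> d x y < \<delta> \<Longrightarrow> d (\<phi> g x) (\<phi> g y) < \<epsilon>/4"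
    using equicontinuous[of "\<epsilon>/4"] assms by auto
  obtain F where F: "finite F" "F \<subseteq> M" "\<And>x. x \<in> M \<Longrightarrow> \<exists>p\<in>F. d p x < \<delta>"
    using finite_ball_cover[OF \<delta>(1)] by metis
  obtain E where E: "finite E" "E \<subseteq> M" "\<And>x. x \<in> M \<Longrightarrow> \<exists>p\<in>E. d p x < \<epsilon>/4"
    using finite_ball_cover[of "\<epsilon>/4"] assms by auto
  \<comment> \<open>\<open>s g\<close> rounds the values of \<open>\<phi> g\<close> on F to points
    of E. Restricting it to F puts all codes into the finite set
    \<open>F \<rightarrow>\<^sub>E E\<close>.\<close>
  define s where "s g = (\<lambda>p\<in>F. SOME q. q \<in> E \<and> d q (\<phi> g p) < \<epsilon>/4)" for g
  have s: "s g p \<in> E" "d (s g p) (\<phi> g p) < \<epsilon>/4" if "g \<in> carrier \<Gamma>" "p \<in> F" for g p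
  proof -
    have "\<phi> g p \<in> M"
      using that F(2) by auto
    then have "\<exists>q. q \<in> E \<and> d q (\<phi> g p) < \<epsilon>/4"
      using E(3) by blast
    from someI_ex[OF this] show "s g p \<in> E" "d (s g p) (\<phi> g p) < \<epsilon>/4"
      using that(2) by (simp_all add: s_def)
  qed
  have "s ` carrier \<Gamma> \<subseteq> F \<rightarrow>\<^sub>E E"
    using s(1) by (auto simp: PiE_iff) (simp add: s_def)
  then have "finite (s ` carrier \<Gamma>)"
    using F(1) E(1) by (meson finite_PiE finite_subset)
  then obtain K where K: "K \<subseteq> carrier \<Gamma>" "finite K" "s ` carrier \<Gamma> = s ` K"
    using finite_subset_image[of "s ` carrier \<Gamma>" s "carrier \<Gamma>"] by auto
  have "\<exists>k\<in>K. \<forall>x\<in>M. d (\<phi> g x) (\<phi> k x) < \<epsilon>" if g: "g \<in> carrier \<Gamma>" for g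
  proof -
    obtain k where k: "k \<in> K" "s g = s k"
      using K(3) g by blast
    then have k': "k \<in> carrier \<Gamma>"
      using K(1) by blast
    have "d (\<phi> g x) (\<phi> k x) < \<epsilon>" if x: "x \<in> M" for x
    proof -
      obtain p where p: "p \<in> F" "d p x < \<delta>"
        using F(3)[OF x] by blast
      then have pM: "p \<in> M" "s g p \<in> M"
        using F(2) E(2) s(1)[OF g] by auto
      \<comment> \<open>Each of the four steps costs \<epsilon>/4: equicontinuity moves x to p under
        g and under k, and rounding passes through the common code
        \<open>s g p = s k p\<close>.\<close>
      have "d (\<phi> g x) (\<phi> k x) \<le> d (\<phi> g p) (\<phi> g x) + d (s g p) (\<phi> g p) + d (s k p) (\<phi> k p) + d (\<phi> k p) (\<phi> k x)"
        using triangle[of "\<phi> g x" "\<phi> g p" "\<phi> k x"] triangle[of "\<phi> g p" "s g p" "\<phi> k x"]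
          triangle[of "s g p" "\<phi> k p" "\<phi> k x"] g k' k(2) x pM
        by (simp add: commute)
      then show ?thesis
        using \<delta>(2)[OF g pM(1) x p(2)] \<delta>(2)[OF k' pM(1) x p(2)] s(2)[OF g p(1)] s(2)[OF k' p(1)]
        by linarith
    qed
    then show ?thesis
      using k(1) by blast
  qed
  then show thesis
    using that K by blast
qed

text \<open>Each f lies within \<delta> of \<open>\<phi> k\<close> for some k in a finite net.
  Applying the inverse of \<open>\<phi> k\<close>, which turns \<delta> into \<epsilon>, shows that
  its product with f moves every point by less than \<epsilon> and so lies in N. Thus finitely many
  cosets exhaust the group.\<close>

lemma finite_index:
  assumes "N \<in> open_normal_subgroups m \<Gamma> \<phi>"
  shows "index GG (carrier GG) N > 0"
proof -
  have sN: "subgroup N GG"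
    using assms normal_imp_subgroup by (auto simp: open_normal_subgroups_def)
  obtain \<epsilon> where \<epsilon>: "\<epsilon> > 0" "\<And>f. f \<in> carrier GG \<Longrightarrow> (\<And>x. x \<in> M \<Longrightarrow> d (f x) x < \<epsilon>) \<Longrightarrow> f \<in> N"
    using assms unfolding open_normal_subgroups_iff by blast
  obtain \<delta> where \<delta>: "\<delta> > 0"
    "\<And>f x y. f \<in> carrier GG \<Longrightarrow> x \<in> M \<Longrightarrow> y \<in> M \<Longrightarrow> d x y < \<delta> \<Longrightarrow> d (f x) (f y) < \<epsilon>"
    using GG_equicontinuous[OF \<epsilon>(1)] by metis
  obtain K where K: "finite K" "K \<subseteq> carrier \<Gamma>"
    "\<And>g. g \<in> carrier \<Gamma> \<Longrightarrow> \<exists>k\<in>K. \<forall>x\<in>M. d (\<phi> g x) (\<phi> k x) < \<delta>/2"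
    using finite_net[of "\<delta>/2"] \<delta>(1) by auto
  have "f <#\<^bsub>GG\<^esub> N \<in> (\<lambda>k. \<phi> k <#\<^bsub>GG\<^esub> N) ` K" if f: "f \<in> carrier GG" for f
  proof -
    obtain g where g: "g \<in> carrier \<Gamma>" "\<And>x. x \<in> M \<Longrightarrow> d (f x) (\<phi> g x) < \<delta>/2"
      using approximableE[of f "\<delta>/2"] f \<delta>(1) by (auto simp: mem_GG)
    obtain k where k: "k \<in> K" "\<And>x. x \<in> M \<Longrightarrow> d (\<phi> g x) (\<phi> k x) < \<delta>/2"
      using K(3)[OF g(1)] by blast
    have kG: "k \<in> carrier \<Gamma>" "\<phi> k \<in> carrier GG"
      using k K(2) phi_GG by auto
    have "d ((inv\<^bsub>GG\<^esub> (\<phi> k) \<otimes>\<^bsub>GG\<^esub> f) x) x < \<epsilon>" if x: "x \<in> M" for x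
    proof -
      have "d (f x) (\<phi> k x) \<le> d (f x) (\<phi> g x) + d (\<phi> g x) (\<phi> k x)"
        using triangle GG_in[OF f x] kG(1) g(1) x by simp
      then have "d (f x) (\<phi> k x) < \<delta>"
        using g(2)[OF x] k(2)[OF x] by linarith
      then have "d ((inv\<^bsub>GG\<^esub> (\<phi> k)) (f x)) ((inv\<^bsub>GG\<^esub> (\<phi> k)) (\<phi> k x)) < \<epsilon>"
        using \<delta>(2)[of "inv\<^bsub>GG\<^esub> (\<phi> k)" "f x" "\<phi> k x"] kG GG_in[OF f x] x by simp
      then show ?thesis
        using kG(2) f x by (simp add: GG_mult_apply GG_inv_apply)
    qed
    then have "inv\<^bsub>GG\<^esub> (\<phi> k) \<otimes>\<^bsub>GG\<^esub> f \<in> N"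
      using \<epsilon>(2) kG(2) f by simp
    then have "\<phi> k <#\<^bsub>GG\<^esub> N = f <#\<^bsub>GG\<^esub> N"
      using GG.l_coset_eq_iff[OF sN kG(2) f] by simp
    then show ?thesis
      using k(1) by (metis imageI)
  qed
  then have "finite ((\<lambda>f. f <#\<^bsub>GG\<^esub> N) ` carrier GG)"
    using K(1) by (meson finite_imageI finite_subset image_subsetI)
  then show ?thesis
    using GG.one_closed by (auto simp: index_def card_gt_0_iff)
qed

text \<open>By equicontinuity the group acts by a totally bounded family, so a sequence moving \<open>x\<close> closer
  and closer to \<open>y\<close> has a uniformly Cauchy subsequence; its limit belongs to the closure group.\<close>

lemma GG_transitive:
  assumes x: "x \<in> M" and y: "y \<in> M"
  obtains f where "f \<in> carrier GG" "f x = y"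
proof -
  have "y \<in> mtopology closure_of orbit \<Gamma> \<phi> x"
    using action x y by (simp add: equicontinuous_cantor_action_def cantor_action_def X_eq)
  then have "\<exists>g\<in>carrier \<Gamma>. d y (\<phi> g x) < 1 / Suc n" for n
    unfolding metric_closure_of orbit_def by (auto dest!: spec[of _ "1 / Suc n"])
  then obtain g where g: "\<And>n. g n \<in> carrier \<Gamma>" "\<And>n. d y (\<phi> (g n) x) < 1 / Suc n"
    by metis
  have "U.mtotally_bounded (\<phi> ` carrier \<Gamma>)"
    unfolding U.mtotally_bounded_def
  proof (intro allI impI)
    fix \<epsilon> :: real assume "\<epsilon> > 0"
    then obtain K where K: "finite K" "K \<subseteq> carrier \<Gamma>"
      "\<And>g. g \<in> carrier \<Gamma> \<Longrightarrow> \<exists>k\<in>K. \<forall>x\<in>M. d (\<phi> g x) (\<phi> k x) < \<epsilon>/2"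
      using finite_net[of "\<epsilon>/2"] by auto
    have "\<phi> g \<in> (\<Union>f\<in>\<phi> ` K. U.mball f \<epsilon>)" if g: "g \<in> carrier \<Gamma>" for g
    proof -
      obtain k where k: "k \<in> K" "\<forall>x\<in>M. d (\<phi> g x) (\<phi> k x) < \<epsilon>/2"
        using K(3)[OF g] by blast
      have kG: "k \<in> carrier \<Gamma>"
        using k K(2) by blast
      have "sup_dist m (\<phi> k) (\<phi> g) \<le> \<epsilon>/2"
        using k by (intro sup_dist_le phi_homeos g kG) (auto simp: commute intro: less_imp_le)
      then have "\<phi> g \<in> U.mball (\<phi> k) \<epsilon>"
        using phi_homeos[OF g] phi_homeos[OF kG] \<open>\<epsilon> > 0\<close> by simp
      then show ?thesis
        using k(1) by blast
    qed
    then show "\<exists>K. finite K \<and> K \<subseteq> \<phi> ` carrier \<Gamma> \<and> \<phi> ` carrier \<Gamma> \<subseteq> (\<Union>f\<in>K. U.mball f \<epsilon>)"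
      using K(1,2) by (intro exI[of _ "\<phi> ` K"]) blast
  qed
  moreover have "range (\<lambda>n. \<phi> (g n)) \<subseteq> \<phi> ` carrier \<Gamma>"
    using g(1) by blast
  ultimately obtain r :: "nat \<Rightarrow> nat" where r: "strict_mono r" "U.MCauchy ((\<lambda>n. \<phi> (g n)) \<circ> r)"
    unfolding U.mtotally_bounded_sequentially by blast
  define h where "h n = g (r n)" for n
  have h: "h n \<in> carrier \<Gamma>" for n
    by (simp add: h_def g)
  have cauchy: "\<exists>n0. \<forall>i\<ge>n0. \<forall>j\<ge>n0. \<forall>z\<in>M. d (\<phi> (h i) z) (\<phi> (h j) z) < \<epsilon>" if "\<epsilon> > 0" for \<epsilon>
  proof -
    obtain n0 where n0: "\<And>i j. n0 \<le> i \<Longrightarrow> n0 \<le> j \<Longrightarrow> sup_dist m (\<phi> (h i)) (\<phi> (h j)) < \<epsilon>"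
      using r(2) \<open>\<epsilon> > 0\<close> unfolding U.MCauchy_def h_def o_def by meson
    then show ?thesis
      using dist_le_sup_dist[OF phi_homeos[OF h] phi_homeos[OF h]] by (metis le_less_trans)
  qed
  have "\<exists>l. limitin mtopology (\<lambda>n. \<phi> (h n) z) l sequentially" if z: "z \<in> M" for z
  proof -
    have "MCauchy (\<lambda>n. \<phi> (h n) z)"
      unfolding MCauchy_def using cauchy z h by (auto, meson)
    then show ?thesis
      using complete_M by (simp add: mcomplete_def)
  qed
  then obtain l where l: "\<And>z. z \<in> M \<Longrightarrow> limitin mtopology (\<lambda>n. \<phi> (h n) z) (l z) sequentially"
    by metis
  define f where "f = (\<lambda>z\<in>M. l z)"
  have f_in: "f z \<in> M" if "z \<in> M" for z
    using limitin_mspace[OF l[OF that]] that by (simp add: f_def)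
  have unif: "\<exists>n0. \<forall>i\<ge>n0. \<forall>z\<in>M. d (f z) (\<phi> (h i) z) < \<epsilon>" if "\<epsilon> > 0" for \<epsilon>
  proof -
    obtain n0 where n0: "\<And>i j z. i \<ge> n0 \<Longrightarrow> j \<ge> n0 \<Longrightarrow> z \<in> M \<Longrightarrow> d (\<phi> (h i) z) (\<phi> (h j) z) < \<epsilon>/2"
      using cauchy[of "\<epsilon>/2"] \<open>\<epsilon> > 0\<close> by auto
    have "d (f z) (\<phi> (h i) z) < \<epsilon>" if i: "i \<ge> n0" and z: "z \<in> M" for i z
    proof -
      \<comment> \<open>\<open>n1\<close> depends on z, but it only serves to pass to the limit at
        z; the bound holds from \<open>n0\<close> on, which does not depend on z.\<close>
      obtain n1 where "\<And>n. n \<ge> n1 \<Longrightarrow> d (\<phi> (h n) z) (l z) < \<epsilon>/2"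
        using l[OF z] \<open>\<epsilon> > 0\<close> unfolding limit_metric_sequentially by (meson half_gt_zero)
      then have "d (\<phi> (h (max n0 n1)) z) (f z) < \<epsilon>/2"
        using z by (simp add: f_def)
      moreover have "d (\<phi> (h (max n0 n1)) z) (\<phi> (h i) z) < \<epsilon>/2"
        using n0 i z by simp
      moreover have "d (f z) (\<phi> (h i) z) \<le> d (\<phi> (h (max n0 n1)) z) (f z) + d (\<phi> (h (max n0 n1)) z) (\<phi> (h i) z)"
        using triangle'[of "f z" "\<phi> (h (max n0 n1)) z" "\<phi> (h i) z"] f_in z h by (simp add: commute)
      ultimately show ?thesis
        by linarith
    qed
    then show ?thesis
      by blast
  qed
  have approx: "approximable f"
    unfolding approximable_def using f_in unif h by (meson order_refl)
  \<comment> \<open>If f identified z and w, some \<open>\<phi> (h n)\<close> would bring them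
    within \<delta>, and its inverse would then give d z w < d z w.\<close>
  have "inj_on f M"
  proof (rule inj_onI, rule ccontr)
    fix z w assume zw: "z \<in> M" "w \<in> M" "f z = f w" "z \<noteq> w"
    then have "d z w > 0"
      by simp
    then obtain \<delta> where \<delta>: "\<delta> > 0"
      "\<And>g x y. g \<in> carrier \<Gamma> \<Longrightarrow> x \<in> M \<Longrightarrow> y \<in> M \<Longrightarrow> d x y < \<delta> \<Longrightarrow> d (\<phi> g x) (\<phi> g y) < d z w"
      using equicontinuous by metis
    obtain n where n: "\<And>z. z \<in> M \<Longrightarrow> d (f z) (\<phi> (h n) z) < \<delta>/2"
      using unif[of "\<delta>/2"] \<delta>(1) by auto
    have "d (\<phi> (h n) z) (\<phi> (h n) w) \<le> d (f z) (\<phi> (h n) z) + d (f w) (\<phi> (h n) w)"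
      using triangle[of "\<phi> (h n) z" "f z" "\<phi> (h n) w"] zw f_in h by (simp add: commute)
    then have "d (\<phi> (h n) z) (\<phi> (h n) w) < \<delta>"
      using n[OF zw(1)] n[OF zw(2)] by linarith
    then have "d (\<phi> (inv\<^bsub>\<Gamma>\<^esub> (h n)) (\<phi> (h n) z)) (\<phi> (inv\<^bsub>\<Gamma>\<^esub> (h n)) (\<phi> (h n) w)) < d z w"
      using \<delta>(2) h zw by simp
    then show False
      using h zw by (simp add: phi_inv)
  qed
  moreover have "f ` M = M"
  proof (intro equalityI subsetI)
    fix w assume w: "w \<in> M"
    have "range (\<lambda>n. \<phi> (inv\<^bsub>\<Gamma>\<^esub> (h n)) w) \<subseteq> M"
      using h w by auto
    \<comment> \<open>The candidate preimage of w is a cluster point z of its preimages under the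
      maps \<open>\<phi> (h n)\<close>. Along the subsequence, the images of z are close to f z by
      uniform convergence and close to w by equicontinuity.\<close>
    then obtain z s where s: "z \<in> M" "strict_mono (s :: nat \<Rightarrow> nat)"
      "limitin mtopology ((\<lambda>n. \<phi> (inv\<^bsub>\<Gamma>\<^esub> (h n)) w) \<circ> s) z sequentially"
      using compact_X unfolding X_eq compact_space_sequentially by meson
    have "d (f z) w < \<epsilon>" if "\<epsilon> > 0" for \<epsilon>
    proof -
      obtain \<delta> where \<delta>: "\<delta> > 0"
        "\<And>g x y. g \<in> carrier \<Gamma> \<Longrightarrow> x \<in> M \<Longrightarrow> y \<in> M \<Longrightarrow> d x y < \<delta> \<Longrightarrow> d (\<phi> g x) (\<phi> g y) < \<epsilon>/2"
        using equicontinuous[of "\<epsilon>/2"] \<open>\<epsilon> > 0\<close> by auto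
      obtain n0 where n0: "\<And>i z. i \<ge> n0 \<Longrightarrow> z \<in> M \<Longrightarrow> d (f z) (\<phi> (h i) z) < \<epsilon>/2"
        using unif[of "\<epsilon>/2"] \<open>\<epsilon> > 0\<close> by auto
      obtain n1 where n1: "\<And>n. n \<ge> n1 \<Longrightarrow> d (\<phi> (inv\<^bsub>\<Gamma>\<^esub> (h (s n))) w) z < \<delta>"
        using s(3) \<delta>(1) unfolding limit_metric_sequentially o_def by meson
      let ?n = "max n0 n1"
      let ?k = "h (s ?n)"
      have "d (f z) (\<phi> ?k z) < \<epsilon>/2"
        using n0[OF _ s(1)] seq_suble[OF s(2), of ?n] by (meson max.cobounded1 order_trans)
      moreover have "d (\<phi> ?k (\<phi> (inv\<^bsub>\<Gamma>\<^esub> ?k) w)) (\<phi> ?k z) < \<epsilon>/2"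
        using n1[of ?n] \<delta>(2) h w s(1) by simp
      then have "d (\<phi> ?k z) w < \<epsilon>/2"
        using h w by (simp add: phi_inv commute)
      moreover have "d (f z) w \<le> d (f z) (\<phi> ?k z) + d (\<phi> ?k z) w"
        using triangle f_in[OF s(1)] h s(1) w by simp
      ultimately show ?thesis
        by linarith
    qed
    from this[of "d (f z) w"] have "d (f z) w = 0"
      using nonneg[of "f z" w] by linarith
    then have "w = f z"
      using f_in[OF s(1)] w by simp
    then show "w \<in> f ` M"
      using s(1) by blast
  qed (use f_in in auto)
  ultimately have "f \<in> Bij M"
    by (simp add: Bij_def bij_betw_def f_def)
  then have "f \<in> carrier GG"
    using approx by (simp add: mem_GG)
  moreover have "f x = y"
  proof -
    have "limitin mtopology (\<lambda>n. \<phi> (g n) x) y sequentially"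
      unfolding limit_metric_sequentially
    proof (intro conjI allI impI)
      fix \<epsilon> :: real assume "\<epsilon> > 0"
      then obtain n0 where n0: "1 / real (Suc n0) < \<epsilon>"
        by (rule nat_approx_posE)
      have "d (\<phi> (g n) x) y < \<epsilon>" if "n \<ge> n0" for n
      proof -
        have "1 / Suc n \<le> 1 / Suc n0"
          using that by (simp add: frac_le)
        then show ?thesis
          using g(2)[of n] n0 by (simp add: commute)
      qed
      then show "\<exists>N. \<forall>n\<ge>N. \<phi> (g n) x \<in> M \<and> d (\<phi> (g n) x) y < \<epsilon>"
        using g(1) x by auto
    qed (rule y)
    then have "limitin mtopology ((\<lambda>n. \<phi> (g n) x) \<circ> r) y sequentially"
      by (rule limitin_subsequence[OF r(1)])
    then have "limitin mtopology (\<lambda>n. \<phi> (h n) x) y sequentially"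
      by (simp add: h_def o_def)
    then show ?thesis
      using l[OF x] limitin_metric_unique x by (fastforce simp: f_def)
  qed
  ultimately show thesis
    by (rule that)
qed

section \<open>The Steinitz orders in terms of indices\<close>

lemma steinitz_order_group_index:
  "steinitz_order_group m \<Gamma> \<phi> =
     steinitz_LCM ((\<lambda>N. steinitz_of_nat (index GG (carrier GG) N)) ` open_normal_subgroups m \<Gamma> \<phi>)"
  unfolding steinitz_order_group_def
  by (intro arg_cong[where f = steinitz_LCM] image_cong refl)
    (simp add: GG.card_carrier_FactGroup open_normal_subgroups_def)

lemma steinitz_order_discriminant_index:
  assumes "x \<in> M"
  shows "steinitz_order_discriminant m \<Gamma> \<phi> x =
     steinitz_LCM ((\<lambda>N. steinitz_of_nat
         (index GG (discriminant m \<Gamma> \<phi> x) (N \<inter> discriminant m \<Gamma> \<phi> x)))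
       ` open_normal_subgroups m \<Gamma> \<phi>)"
  unfolding steinitz_order_discriminant_def Let_def
  by (intro arg_cong[where f = steinitz_LCM] image_cong refl)
    (simp add: GG.card_carrier_FactGroup_Int discriminant_subgroup assms open_normal_subgroups_def)

lemma steinitz_relative_order_index:
  "steinitz_relative_order m \<Gamma> \<phi> x =
     steinitz_LCM ((\<lambda>N. steinitz_of_nat
         (index GG (carrier GG) (N <#>\<^bsub>GG\<^esub> discriminant m \<Gamma> \<phi> x)))
       ` open_normal_subgroups m \<Gamma> \<phi>)"
  by (simp add: steinitz_relative_order_def Let_def GG.card_lcosets)

lemma lagrange_identity:
  assumes "x \<in> M"
  shows "steinitz_order_group m \<Gamma> \<phi> =
    steinitz_relative_order m \<Gamma> \<phi> x * steinitz_order_discriminant m \<Gamma> \<phi> x"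
  unfolding steinitz_order_group_index steinitz_relative_order_index
    steinitz_order_discriminant_index[OF assms]
  using GG.is_group discriminant_subgroup[OF assms] open_normal_subgroups_nonempty finite_index
    open_normal_subgroups_Int
  by (intro steinitz_lagrange) (auto simp: open_normal_subgroups_def)

end

text \<open>Applied twice: with \<psi> the conjugation by an element of one closure group, for a
  change of basepoint, and with \<psi> the conjugation by a homeomorphism, for isomorphic
  actions.\<close>

lemma steinitz_orders_cong:
  assumes "equicontinuous_cantor m \<Gamma> \<phi>" "equicontinuous_cantor m' \<Gamma>' \<phi>'"
    and x: "x \<in> mspace m" and y: "y \<in> mspace m'"
    and \<psi>: "\<psi> \<in> iso (closure_group m \<Gamma> \<phi>) (closure_group m' \<Gamma>' \<phi>')"
    and opn: "open_normal_subgroups m' \<Gamma>' \<phi>' = (`) \<psi> ` open_normal_subgroups m \<Gamma> \<phi>"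
    and D: "discriminant m' \<Gamma>' \<phi>' y = \<psi> ` discriminant m \<Gamma> \<phi> x"
  shows "steinitz_order_group m \<Gamma> \<phi> = steinitz_order_group m' \<Gamma>' \<phi>'"
    and "steinitz_order_discriminant m \<Gamma> \<phi> x = steinitz_order_discriminant m' \<Gamma>' \<phi>' y"
    and "steinitz_relative_order m \<Gamma> \<phi> x = steinitz_relative_order m' \<Gamma>' \<phi>' y"
proof -
  interpret A: equicontinuous_cantor m \<Gamma> \<phi> by fact
  interpret B: equicontinuous_cantor m' \<Gamma>' \<phi>' by fact
  have normal: "N \<lhd> A.GG" if "N \<in> open_normal_subgroups m \<Gamma> \<phi>" for N
    using that by (simp add: open_normal_subgroups_def)
  note eqs = steinitz_orders_iso_image[OF A.GG.is_group B.GG.is_group \<psi> A.discriminant_subgroup[OF x] normal]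
  show "steinitz_order_group m \<Gamma> \<phi> = steinitz_order_group m' \<Gamma>' \<phi>'"
    by (simp only: A.steinitz_order_group_index B.steinitz_order_group_index opn eqs)
  show "steinitz_order_discriminant m \<Gamma> \<phi> x = steinitz_order_discriminant m' \<Gamma>' \<phi>' y"
    by (simp only: A.steinitz_order_discriminant_index[OF x] B.steinitz_order_discriminant_index[OF y]
        opn D eqs)
  show "steinitz_relative_order m \<Gamma> \<phi> x = steinitz_relative_order m' \<Gamma>' \<phi>' y"
    by (simp only: A.steinitz_relative_order_index B.steinitz_relative_order_index opn D eqs)
qed

lemma (in equicontinuous_cantor) basepoint_independence:
  assumes x: "x \<in> M" and y: "y \<in> M"
  shows "steinitz_order_discriminant m \<Gamma> \<phi> x = steinitz_order_discriminant m \<Gamma> \<phi> y"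
    and "steinitz_relative_order m \<Gamma> \<phi> x = steinitz_relative_order m \<Gamma> \<phi> y"
proof -
  obtain g where g: "g \<in> carrier GG" "g x = y"
    using GG_transitive[OF x y] .
  define c where "c f = g \<otimes>\<^bsub>GG\<^esub> f \<otimes>\<^bsub>GG\<^esub> inv\<^bsub>GG\<^esub> g" for f
  define c' where "c' f = inv\<^bsub>GG\<^esub> g \<otimes>\<^bsub>GG\<^esub> f \<otimes>\<^bsub>GG\<^esub> g" for f
  have in_GG: "c f \<in> carrier GG" "c' f \<in> carrier GG" if "f \<in> carrier GG" for f
    using g that by (simp_all add: c_def c'_def)
  have cc': "c (c' f) = f" "c' (c f) = f" if "f \<in> carrier GG" for f
    using g that GG.inv_solve_left GG.inv_solve_right
    by (simp_all add: c_def c'_def GG.m_assoc) (simp_all add: GG.m_assoc[symmetric])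
  have "c \<in> hom GG GG"
  proof (rule homI)
    fix a b assume ab: "a \<in> carrier GG" "b \<in> carrier GG"
    have "c a \<otimes>\<^bsub>GG\<^esub> c b = g \<otimes>\<^bsub>GG\<^esub> a \<otimes>\<^bsub>GG\<^esub> (inv\<^bsub>GG\<^esub> g \<otimes>\<^bsub>GG\<^esub> g) \<otimes>\<^bsub>GG\<^esub> b \<otimes>\<^bsub>GG\<^esub> inv\<^bsub>GG\<^esub> g"
      using g(1) ab unfolding c_def by (simp only: GG.m_assoc GG.m_closed GG.inv_closed)
    then show "c (a \<otimes>\<^bsub>GG\<^esub> b) = c a \<otimes>\<^bsub>GG\<^esub> c b"
      using g(1) ab by (simp add: c_def GG.m_assoc)
  qed (use in_GG in auto)
  moreover have bij: "bij_betw c (carrier GG) (carrier GG)"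
    by (rule bij_betw_byWitness[of _ c']) (use in_GG cc' in auto)
  ultimately have iso: "c \<in> iso GG GG"
    by (simp add: iso_def)
  \<comment> \<open>Normality gives invariance of N under conjugation by g and by its inverse; the
    latter provides the preimages.\<close>
  have "c ` N = N" if N: "N \<in> open_normal_subgroups m \<Gamma> \<phi>" for N
  proof -
    have n: "N \<lhd> GG"
      using N by (simp add: open_normal_subgroups_def)
    have sub: "N \<subseteq> carrier GG"
      by (rule subgroup.subset[OF normal_imp_subgroup[OF n]])
    have "c f \<in> N" "c' f \<in> N" if "f \<in> N" for f
      using normal.inv_op_closed2[OF n g(1) that] normal.inv_op_closed1[OF n g(1) that]
      by (simp_all add: c_def c'_def)
    moreover from this have "f \<in> c ` N" if "f \<in> N" for f
      using cc'(1)[OF subsetD[OF sub that]] that by (intro image_eqI[of f c "c' f"]) auto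
    ultimately show ?thesis
      by blast
  qed
  then have opn: "open_normal_subgroups m \<Gamma> \<phi> = (`) c ` open_normal_subgroups m \<Gamma> \<phi>"
    by simp
  have inv_g: "(inv\<^bsub>GG\<^esub> g) y = x"
    using g(2) GG_inv_apply(1)[OF g(1) x] by simp
  \<comment> \<open>c f sends y to g (f x), and g is injective with g x = y.\<close>
  have fix_iff: "c f y = y \<longleftrightarrow> f x = x" if f: "f \<in> carrier GG" for f
  proof -
    have "c f y = (g \<otimes>\<^bsub>GG\<^esub> f) x"
      using g(1) f y by (simp add: c_def GG_mult_apply inv_g)
    then have "c f y = g (f x)"
      using g(1) f x by (simp add: GG_mult_apply)
    then show ?thesis
      using g GG_inv_apply(1)[OF g(1) x] GG_inv_apply(1)[OF g(1) GG_in[OF f x]] by metis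
  qed
  have D: "discriminant m \<Gamma> \<phi> y = c ` discriminant m \<Gamma> \<phi> x"
  proof (intro equalityI subsetI)
    fix f assume "f \<in> discriminant m \<Gamma> \<phi> y"
    then have f: "f \<in> carrier GG" "f y = y"
      by (auto simp: discriminant_def stabilizer_def)
    then have "c' f \<in> discriminant m \<Gamma> \<phi> x"
      using fix_iff[OF in_GG(2)[OF f(1)]] in_GG cc' by (simp add: discriminant_def stabilizer_def)
    then show "f \<in> c ` discriminant m \<Gamma> \<phi> x"
      using cc'(1)[OF f(1)] by (metis image_eqI)
  qed (auto simp: discriminant_def stabilizer_def fix_iff in_GG)
  note * = steinitz_orders_cong[OF equicontinuous_cantor_axioms equicontinuous_cantor_axioms x y iso opn D]
  show "steinitz_order_discriminant m \<Gamma> \<phi> x = steinitz_order_discriminant m \<Gamma> \<phi> y"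
    and "steinitz_relative_order m \<Gamma> \<phi> x = steinitz_relative_order m \<Gamma> \<phi> y"
    by (fact *)+
qed


section \<open>Isomorphic actions\<close>

text \<open>Conjugation by h, restricted to S because elements of the closure group are
  extensional.\<close>

definition transport :: "('x \<Rightarrow> 'y) \<Rightarrow> ('y \<Rightarrow> 'x) \<Rightarrow> 'y set \<Rightarrow> ('x \<Rightarrow> 'x) \<Rightarrow> 'y \<Rightarrow> 'y" where
  "transport h h' S f = (\<lambda>y\<in>S. h (f (h' y)))"

text \<open>The group isomorphism is replaced by the two conditions that \<open>h\<close> conjugates the image of either group
  into that of the other, which makes the situation symmetric in the two actions.\<close>

locale action_conjugacy =
  A: equicontinuous_cantor m \<Gamma> \<phi> + B: equicontinuous_cantor m' \<Gamma>' \<phi>'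
  for m :: "'x metric" and \<Gamma> :: "('g, 'c) monoid_scheme" and \<phi> :: "'g \<Rightarrow> 'x \<Rightarrow> 'x"
    and m' :: "'y metric" and \<Gamma>' :: "('h, 'd) monoid_scheme" and \<phi>' :: "'h \<Rightarrow> 'y \<Rightarrow> 'y" +
  fixes h :: "'x \<Rightarrow> 'y" and h' :: "'y \<Rightarrow> 'x"
  assumes homeo: "homeomorphic_maps (mtopology_of m) (mtopology_of m') h h'"
    and conj: "g \<in> carrier \<Gamma> \<Longrightarrow> \<exists>g'\<in>carrier \<Gamma>'. \<forall>x\<in>mspace m. h (\<phi> g x) = \<phi>' g' (h x)"
    and conj': "g' \<in> carrier \<Gamma>' \<Longrightarrow> \<exists>g\<in>carrier \<Gamma>. \<forall>x\<in>mspace m. h (\<phi> g x) = \<phi>' g' (h x)"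
begin

lemma h_in [simp]: "x \<in> A.M \<Longrightarrow> h x \<in> B.M"
  and h'_in [simp]: "y \<in> B.M \<Longrightarrow> h' y \<in> A.M"
  using homeo continuous_map_funspace[of A.X B.X h] continuous_map_funspace[of B.X A.X h']
  by (auto simp: homeomorphic_maps_def)

lemma h'_h [simp]: "x \<in> A.M \<Longrightarrow> h' (h x) = x"
  and h_h' [simp]: "y \<in> B.M \<Longrightarrow> h (h' y) = y"
  using homeo by (auto simp: homeomorphic_maps_def)

lemma h_uniform:
  assumes "\<epsilon> > 0"
  obtains \<delta> where "\<delta> > 0" "\<And>x y. x \<in> A.M \<Longrightarrow> y \<in> A.M \<Longrightarrow> A.d x y < \<delta> \<Longrightarrow> B.d (h x) (h y) < \<epsilon>"
proof -
  have "uniformly_continuous_map m m' h"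
    using A.compact_X homeo by (intro continuous_imp_uniformly_continuous_map) (simp add: homeomorphic_maps_def)
  then show thesis
    using that assms unfolding uniformly_continuous_map_def by meson
qed

text \<open>Makes every result about \<open>transport h h'\<close> available for the inverse map
  \<open>transport h' h\<close>, and so yields surjectivity and the reverse inclusions
  below.\<close>

lemma symmetric: "action_conjugacy m' \<Gamma>' \<phi>' m \<Gamma> \<phi> h' h"
proof
  show "homeomorphic_maps B.X A.X h' h"
    by (rule iffD1[OF homeomorphic_maps_sym homeo])
  have sym: "\<forall>y\<in>B.M. h' (\<phi>' g' y) = \<phi> g (h' y)"
    if "g \<in> carrier \<Gamma>" "\<forall>x\<in>A.M. h (\<phi> g x) = \<phi>' g' (h x)" for g g'
  proof
    fix y assume y: "y \<in> B.M"
    then have "\<phi>' g' y = h (\<phi> g (h' y))"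
      using that by simp
    then show "h' (\<phi>' g' y) = \<phi> g (h' y)"
      using that(1) y by simp
  qed
  show "\<exists>g\<in>carrier \<Gamma>. \<forall>y\<in>B.M. h' (\<phi>' g' y) = \<phi> g (h' y)" if "g' \<in> carrier \<Gamma>'" for g'
    using conj'[OF that] sym by blast
  show "\<exists>g'\<in>carrier \<Gamma>'. \<forall>y\<in>B.M. h' (\<phi>' g' y) = \<phi> g (h' y)" if "g \<in> carrier \<Gamma>" for g
    using conj[OF that] sym that by blast
qed

lemma transport_apply [simp]: "y \<in> B.M \<Longrightarrow> transport h h' B.M f y = h (f (h' y))"
  by (simp add: transport_def)

text \<open>If \<open>\<phi> a\<close> is uniformly close to f, then uniform continuity of h makes
  the conjugate of \<open>\<phi> a\<close> uniformly close to that of f, and by \<open>conj\<close>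
  the former is the action of some \<open>a'\<close>.\<close>

lemma transport_GG:
  assumes f: "f \<in> carrier A.GG"
  shows "transport h h' B.M f \<in> carrier B.GG"
proof -
  have fB: "f \<in> Bij A.M" and approx: "A.approximable f"
    using f by (auto simp: A.mem_GG)
  have "bij_betw h A.M B.M" "bij_betw h' B.M A.M"
    by (rule bij_betw_byWitness[of _ h'] bij_betw_byWitness[of _ h]; auto)+
  then have "bij_betw (h \<circ> (f \<circ> h')) B.M B.M"
    using fB by (auto simp: Bij_def intro: bij_betw_trans)
  then have "bij_betw (transport h h' B.M f) B.M B.M"
    by (rule iffD1[OF bij_betw_cong, rotated]) simp
  then have "transport h h' B.M f \<in> Bij B.M"
    by (simp add: Bij_def transport_def)
  moreover have "B.approximable (transport h h' B.M f)"
    unfolding B.approximable_def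
  proof (intro conjI allI impI)
    show "\<forall>y\<in>B.M. transport h h' B.M f y \<in> B.M"
      using f by (simp add: A.GG_in)
    fix \<epsilon> :: real assume "\<epsilon> > 0"
    then obtain \<delta> where \<delta>: "\<delta> > 0"
      "\<And>x y. x \<in> A.M \<Longrightarrow> y \<in> A.M \<Longrightarrow> A.d x y < \<delta> \<Longrightarrow> B.d (h x) (h y) < \<epsilon>"
      using h_uniform by metis
    obtain a where a: "a \<in> carrier \<Gamma>" "\<And>x. x \<in> A.M \<Longrightarrow> A.d (f x) (\<phi> a x) < \<delta>"
      using A.approximableE[OF approx \<delta>(1)] by metis
    obtain a' where a': "a' \<in> carrier \<Gamma>'" "\<And>x. x \<in> A.M \<Longrightarrow> h (\<phi> a x) = \<phi>' a' (h x)"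
      using conj[OF a(1)] by blast
    have "B.d (transport h h' B.M f y) (\<phi>' a' y) < \<epsilon>" if y: "y \<in> B.M" for y
    proof -
      have "B.d (h (f (h' y))) (h (\<phi> a (h' y))) < \<epsilon>"
        using y a by (intro \<delta>(2)) (simp_all add: A.GG_in[OF f])
      then show ?thesis
        using y a'(2)[of "h' y"] by simp
    qed
    then show "\<exists>g\<in>carrier \<Gamma>'. \<forall>y\<in>B.M. B.d (transport h h' B.M f y) (\<phi>' g y) < \<epsilon>"
      using a'(1) by blast
  qed
  ultimately show ?thesis
    by (simp add: B.mem_GG)
qed

lemma transport_transport:
  assumes "f \<in> carrier A.GG"
  shows "transport h' h A.M (transport h h' B.M f) = f"
proof (rule extensionalityI[where A = A.M])
  show "f \<in> extensional A.M"
    using assms by (simp add: A.mem_GG Bij_def)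
qed (simp_all add: transport_def A.GG_in[OF assms])

text \<open>Pulled back by h', a map that moves all points of the second space by less than \<delta>
  moves those of the first by less than \<epsilon>, by uniform continuity of h', and so lies in
  N.\<close>

lemma transport_open_normal:
  assumes \<psi>: "transport h h' B.M \<in> iso A.GG B.GG"
    and N: "N \<in> open_normal_subgroups m \<Gamma> \<phi>"
  shows "transport h h' B.M ` N \<in> open_normal_subgroups m' \<Gamma>' \<phi>'"
  unfolding B.open_normal_subgroups_iff
proof
  interpret S: action_conjugacy m' \<Gamma>' \<phi>' m \<Gamma> \<phi> h' h
    by (rule symmetric)
  have n: "N \<lhd> A.GG"
    using N by (simp add: open_normal_subgroups_def)
  show "transport h h' B.M ` N \<lhd> B.GG"
    by (rule iso_normal_subgroup[OF \<psi> A.GG.is_group B.GG.is_group n])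
  obtain \<epsilon> where \<epsilon>: "\<epsilon> > 0" "\<And>f. f \<in> carrier A.GG \<Longrightarrow> (\<And>x. x \<in> A.M \<Longrightarrow> A.d (f x) x < \<epsilon>) \<Longrightarrow> f \<in> N"
    using N unfolding A.open_normal_subgroups_iff by blast
  obtain \<delta> where \<delta>: "\<delta> > 0"
    "\<And>x y. x \<in> B.M \<Longrightarrow> y \<in> B.M \<Longrightarrow> B.d x y < \<delta> \<Longrightarrow> A.d (h' x) (h' y) < \<epsilon>"
    using S.h_uniform[OF \<epsilon>(1)] by metis
  have "f \<in> transport h h' B.M ` N" if f: "f \<in> carrier B.GG" "\<And>y. y \<in> B.M \<Longrightarrow> B.d (f y) y < \<delta>" for f
  proof (rule image_eqI)
    show "f = transport h h' B.M (transport h' h A.M f)"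
      using S.transport_transport[OF f(1)] by simp
    show "transport h' h A.M f \<in> N"
    proof (rule \<epsilon>(2)[OF S.transport_GG[OF f(1)]])
      fix x assume x: "x \<in> A.M"
      have "A.d (h' (f (h x))) (h' (h x)) < \<epsilon>"
        using x f by (intro \<delta>(2)) (simp_all add: B.GG_in)
      then show "A.d (transport h' h A.M f x) x < \<epsilon>"
        using x by simp
    qed
  qed
  then show "\<exists>\<epsilon>>0. \<forall>f\<in>carrier B.GG. (\<forall>y\<in>B.M. B.d (f y) y < \<epsilon>) \<longrightarrow> f \<in> transport h h' B.M ` N"
    using \<delta>(1) by blast
qed

lemma transport_iso: "transport h h' B.M \<in> iso A.GG B.GG"
proof -
  interpret S: action_conjugacy m' \<Gamma>' \<phi>' m \<Gamma> \<phi> h' h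
    by (rule symmetric)
  have "transport h h' B.M \<in> hom A.GG B.GG"
  proof (rule homI)
    fix f g assume fg: "f \<in> carrier A.GG" "g \<in> carrier A.GG"
    show "transport h h' B.M (f \<otimes>\<^bsub>A.GG\<^esub> g) =
        transport h h' B.M f \<otimes>\<^bsub>B.GG\<^esub> transport h h' B.M g"
      unfolding B.GG_mult[OF transport_GG[OF fg(1)] transport_GG[OF fg(2)]]
      using fg by (auto simp: transport_def compose_def A.GG_mult_apply A.GG_in)
  qed (rule transport_GG)
  moreover have "bij_betw (transport h h' B.M) (carrier A.GG) (carrier B.GG)"
    by (rule bij_betw_byWitness[of _ "transport h' h A.M"])
      (auto simp: transport_transport S.transport_transport transport_GG S.transport_GG)
  ultimately show ?thesis
    by (simp add: iso_def)
qed

lemma transport_discriminant: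
  assumes x: "x \<in> A.M"
  shows "discriminant m' \<Gamma>' \<phi>' (h x) = transport h h' B.M ` discriminant m \<Gamma> \<phi> x"
proof (intro equalityI subsetI)
  interpret S: action_conjugacy m' \<Gamma>' \<phi>' m \<Gamma> \<phi> h' h
    by (rule symmetric)
  fix f assume "f \<in> discriminant m' \<Gamma>' \<phi>' (h x)"
  then have f: "f \<in> carrier B.GG" "f (h x) = h x"
    by (auto simp: discriminant_def stabilizer_def)
  show "f \<in> transport h h' B.M ` discriminant m \<Gamma> \<phi> x"
  proof (rule image_eqI)
    show "f = transport h h' B.M (transport h' h A.M f)"
      using S.transport_transport[OF f(1)] by simp
    show "transport h' h A.M f \<in> discriminant m \<Gamma> \<phi> x"
      using f x S.transport_GG by (simp add: discriminant_def stabilizer_def)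
  qed
qed (use x transport_GG in \<open>auto simp: discriminant_def stabilizer_def\<close>)

text \<open>The second inclusion comes from the first: N is carried back by the inverse transport,
  and the result is carried forward again.\<close>

lemma transport_open_normal_subgroups:
  "open_normal_subgroups m' \<Gamma>' \<phi>' = (`) (transport h h' B.M) ` open_normal_subgroups m \<Gamma> \<phi>"
proof (intro equalityI subsetI)
  interpret S: action_conjugacy m' \<Gamma>' \<phi>' m \<Gamma> \<phi> h' h
    by (rule symmetric)
  fix N assume N: "N \<in> open_normal_subgroups m' \<Gamma>' \<phi>'"
  then have "N \<subseteq> carrier B.GG"
    using subgroup.subset[OF normal_imp_subgroup] by (auto simp: open_normal_subgroups_def)
  then have "transport h h' B.M ` transport h' h A.M ` N = N"
    using S.transport_transport by (force simp: image_image)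
  then show "N \<in> (`) (transport h h' B.M) ` open_normal_subgroups m \<Gamma> \<phi>"
    using S.transport_open_normal[OF S.transport_iso N] by (metis imageI)
qed (use transport_open_normal[OF transport_iso] in blast)

text \<open>Transport compares x with h x only; basepoint independence in the second action then
  replaces h x by an arbitrary y.\<close>

lemma steinitz_orders_eq:
  assumes x: "x \<in> A.M" and y: "y \<in> B.M"
  shows "steinitz_order_group m \<Gamma> \<phi> = steinitz_order_group m' \<Gamma>' \<phi>'"
    and "steinitz_order_discriminant m \<Gamma> \<phi> x = steinitz_order_discriminant m' \<Gamma>' \<phi>' y"
    and "steinitz_relative_order m \<Gamma> \<phi> x = steinitz_relative_order m' \<Gamma>' \<phi>' y"
  using steinitz_orders_cong[OF A.equicontinuous_cantor_axioms B.equicontinuous_cantor_axioms x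
      h_in[OF x] transport_iso transport_open_normal_subgroups transport_discriminant[OF x]]
    B.basepoint_independence[OF h_in[OF x] y]
  by simp_all

end

lemma isomorphic_actions_conjugacy:
  assumes "equicontinuous_cantor_action m \<Gamma> \<phi>" "equicontinuous_cantor_action m' \<Gamma>' \<phi>'"
    and iso: "isomorphic_actions (mtopology_of m) \<Gamma> \<phi> (mtopology_of m') \<Gamma>' \<phi>'"
  obtains h h' where "action_conjugacy m \<Gamma> \<phi> m' \<Gamma>' \<phi>' h h'"
proof -
  interpret A: equicontinuous_cantor m \<Gamma> \<phi>
    using assms by unfold_locales
  interpret B: equicontinuous_cantor m' \<Gamma>' \<phi>'
    using assms by unfold_locales
  obtain h h' \<Theta> where h: "homeomorphic_maps A.X B.X h h'" and \<Theta>: "\<Theta> \<in> iso \<Gamma> \<Gamma>'"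
    and eq: "\<And>g x. g \<in> carrier \<Gamma> \<Longrightarrow> x \<in> A.M \<Longrightarrow> \<phi> g x = h' (\<phi>' (\<Theta> g) (h x))"
    using iso unfolding isomorphic_actions_def by auto
  have im: "\<Theta> ` carrier \<Gamma> = carrier \<Gamma>'"
    using \<Theta> by (auto simp: iso_def bij_betw_def)
  have h_in: "h x \<in> B.M" if "x \<in> A.M" for x
    using that h continuous_map_funspace[of A.X B.X h] by (auto simp: homeomorphic_maps_def)
  have h_h': "h (h' y) = y" if "y \<in> B.M" for y
    using that h by (auto simp: homeomorphic_maps_def)
  have *: "\<forall>x\<in>A.M. h (\<phi> g x) = \<phi>' (\<Theta> g) (h x)" if g: "g \<in> carrier \<Gamma>" for g
  proof
    fix x assume "x \<in> A.M"
    moreover have "\<Theta> g \<in> carrier \<Gamma>'"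
      using g im by blast
    ultimately show "h (\<phi> g x) = \<phi>' (\<Theta> g) (h x)"
      using g by (simp add: eq h_h' h_in)
  qed
  have "action_conjugacy m \<Gamma> \<phi> m' \<Gamma>' \<phi>' h h'"
  proof
    show "homeomorphic_maps A.X B.X h h'"
      by (rule h)
    show "\<exists>g'\<in>carrier \<Gamma>'. \<forall>x\<in>A.M. h (\<phi> g x) = \<phi>' g' (h x)" if "g \<in> carrier \<Gamma>" for g
      using *[OF that] that im by (intro bexI[of _ "\<Theta> g"]) auto
    \<comment> \<open>This condition is where surjectivity of \<Theta> enters.\<close>
    show "\<exists>g\<in>carrier \<Gamma>. \<forall>x\<in>A.M. h (\<phi> g x) = \<phi>' g' (h x)" if g': "g' \<in> carrier \<Gamma>'" for g'
    proof -
      obtain g where "g \<in> carrier \<Gamma>" "g' = \<Theta> g"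
        using g' im by (metis imageE)
      then show ?thesis
        using *[of g] by (intro bexI[of _ g]) auto
    qed
  qed
  then show thesis
    by (rule that)
qed

theorem theorem1p6:
  fixes m :: "'x metric" and \<Gamma> :: "('g, 'c) monoid_scheme" and \<phi> :: "'g \<Rightarrow> 'x \<Rightarrow> 'x"
  assumes "equicontinuous_cantor_action m \<Gamma> \<phi>"
  shows
    "(\<forall>x\<in>mspace m. \<forall>y\<in>mspace m.
        steinitz_order_discriminant m \<Gamma> \<phi> x = steinitz_order_discriminant m \<Gamma> \<phi> y \<and>
        steinitz_relative_order m \<Gamma> \<phi> x = steinitz_relative_order m \<Gamma> \<phi> y) \<and>
     (\<forall>(m' :: 'y metric) (\<Gamma>' :: ('h, 'd) monoid_scheme) (\<phi>' :: 'h \<Rightarrow> 'y \<Rightarrow> 'y).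
        equicontinuous_cantor_action m' \<Gamma>' \<phi>' \<longrightarrow>
        isomorphic_actions (mtopology_of m) \<Gamma> \<phi> (mtopology_of m') \<Gamma>' \<phi>' \<longrightarrow>
        steinitz_order_group m \<Gamma> \<phi> = steinitz_order_group m' \<Gamma>' \<phi>' \<and>
        (\<forall>x\<in>mspace m. \<forall>y\<in>mspace m'.
           steinitz_order_discriminant m \<Gamma> \<phi> x = steinitz_order_discriminant m' \<Gamma>' \<phi>' y \<and>
           steinitz_relative_order m \<Gamma> \<phi> x = steinitz_relative_order m' \<Gamma>' \<phi>' y)) \<and>
     (\<forall>x\<in>mspace m.
        steinitz_order_group m \<Gamma> \<phi> =
          steinitz_relative_order m \<Gamma> \<phi> x * steinitz_order_discriminant m \<Gamma> \<phi> x)"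
proof -
  interpret A: equicontinuous_cantor m \<Gamma> \<phi>
    using assms by unfold_locales
  show ?thesis
  proof (intro conjI allI impI)
    show "\<forall>x\<in>mspace m. \<forall>y\<in>mspace m.
        steinitz_order_discriminant m \<Gamma> \<phi> x = steinitz_order_discriminant m \<Gamma> \<phi> y \<and>
        steinitz_relative_order m \<Gamma> \<phi> x = steinitz_relative_order m \<Gamma> \<phi> y"
      using A.basepoint_independence by blast
    show "\<forall>x\<in>mspace m. steinitz_order_group m \<Gamma> \<phi> =
        steinitz_relative_order m \<Gamma> \<phi> x * steinitz_order_discriminant m \<Gamma> \<phi> x"
      using A.lagrange_identity by blast
  next
    fix m' :: "'y metric" and \<Gamma>' :: "('h, 'd) monoid_scheme" and \<phi>' :: "'h \<Rightarrow> 'y \<Rightarrow> 'y"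
    assume action': "equicontinuous_cantor_action m' \<Gamma>' \<phi>'"
      and iso: "isomorphic_actions (mtopology_of m) \<Gamma> \<phi> (mtopology_of m') \<Gamma>' \<phi>'"
    obtain h h' where "action_conjugacy m \<Gamma> \<phi> m' \<Gamma>' \<phi>' h h'"
      using isomorphic_actions_conjugacy[OF assms action' iso] .
    then interpret action_conjugacy m \<Gamma> \<phi> m' \<Gamma>' \<phi>' h h' .
    show "steinitz_order_group m \<Gamma> \<phi> = steinitz_order_group m' \<Gamma>' \<phi>'"
      \<comment> \<open>The order of the whole group mentions no basepoint, but
        \<open>steinitz_orders_eq\<close> does; nonemptiness of the two spaces provides
        them.\<close>
      using steinitz_orders_eq(1) A.M_nonempty B.M_nonempty by blast
    show "\<forall>x\<in>mspace m. \<forall>y\<in>mspace m'.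
        steinitz_order_discriminant m \<Gamma> \<phi> x = steinitz_order_discriminant m' \<Gamma>' \<phi>' y \<and>
        steinitz_relative_order m \<Gamma> \<phi> x = steinitz_relative_order m' \<Gamma>' \<phi>' y"
      using steinitz_orders_eq(2,3) by blast
  qed
qed

end
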